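(* Let $2<p<\infty$ and let $\mu$ be a positive measure. If the dimension of $L_p(\mu)$ is greater than or equal to $2$, then $L_p(\mu)$ is not a universal pointwise BPB domain space.
   Context: Banach spaces are over $\mathbb{K}$, where $\mathbb{K}=\mathbb{R}$ or $\mathbb{K}=\mathbb{C}$. $\mathcal{L}(X,Y)$ is the Banach space of bounded linear operators from $X$ to $Y$; $S_X$ is the unit sphere of $X$. A pair $(X,Y)$ of Banach spaces has the pointwise BPB property if for every $\varepsilon>0$ there is $\eta>0$ such that whenever $T\in\mathcal{L}(X,Y)$ with $\|T\|=1$ and $x_0\in S_X$ satisfy $\|T(x_0)\|>1-\eta$, there is $S\in\mathcal{L}(X,Y)$ with $\|S\|=1$, $\|S(x_0)\|=1$ and $\|S-T\|<\varepsilon$. A Banach space $X$ is a universal pointwise BPB domain space if $(X,Y)$ has the pointwise BPB property for every Banach space $Y$. *)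

theory Defs
  imports
    "HOL-Analysis.Analysis"
    "HOL-Algebra.Module"
    "HOL-Algebra.Algebraic_Closure_Type"
    "HOL-Library.Extended_Nat"
begin

section \<open>Banach spaces over the scalar field\<close>

text \<open>
  The property under study quantifies over all Banach spaces, so a Banach space has to be an
  object rather than a type: it is an HOL-Algebra module over \<^term>\<open>ring_of_type_algebra\<close>
  together with a norm. The scalar field \<open>'k\<close> is meant to be \<^typ>\<open>real\<close> or \<^typ>\<open>complex\<close>.
  The fields \<^const>\<open>monoid.mult\<close> and \<^const>\<open>monoid.one\<close>, which the module record inherits
  from rings, are irrelevant and never constrained.
\<close>

record ('k, 'v) nvs = "('k, 'v) module" +
  vnorm :: "'v \<Rightarrow> real"

locale normed_space = Module.module "ring_of_type_algebra :: 'k ring" V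
  for V :: "('k::real_normed_field, 'v) nvs" (structure) +
  assumes vnorm_nonneg: "x \<in> carrier V \<Longrightarrow> 0 \<le> vnorm V x"
    and vnorm_eq_zero: "x \<in> carrier V \<Longrightarrow> vnorm V x = 0 \<longleftrightarrow> x = \<zero>"
    and vnorm_triangle:
      "x \<in> carrier V \<Longrightarrow> y \<in> carrier V \<Longrightarrow> vnorm V (x \<oplus> y) \<le> vnorm V x + vnorm V y"
    and vnorm_smult: "x \<in> carrier V \<Longrightarrow> vnorm V (c \<odot> x) = norm c * vnorm V x"

locale banach_space = normed_space V for V (structure) +
  assumes complete:
    "(\<And>n. s n \<in> carrier V) \<Longrightarrow>
     (\<And>e. e > 0 \<Longrightarrow> \<exists>N. \<forall>m\<ge>N. \<forall>n\<ge>N. vnorm V (s m \<ominus> s n) < e) \<Longrightarrow>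
     \<exists>x\<in>carrier V. (\<lambda>n. vnorm V (s n \<ominus> x)) \<longlonglongrightarrow> 0"

definition unit_sphere :: "('k, 'v) nvs \<Rightarrow> 'v set" where
  "unit_sphere V = {x \<in> carrier V. vnorm V x = 1}"

definition lin_indep :: "('k::real_normed_field, 'v) nvs \<Rightarrow> 'v set \<Rightarrow> bool" where
  "lin_indep V B \<longleftrightarrow> finite B \<and> B \<subseteq> carrier V \<and>
     (\<forall>c. (\<Oplus>\<^bsub>V\<^esub>v\<in>B. c v \<odot>\<^bsub>V\<^esub> v) = \<zero>\<^bsub>V\<^esub> \<longrightarrow> (\<forall>v\<in>B. c v = 0))"

text \<open>Dimension over \<open>'k\<close>; infinite-dimensional spaces have dimension \<open>\<infinity>\<close>.\<close>

definition vdim :: "('k::real_normed_field, 'v) nvs \<Rightarrow> enat" where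
  "vdim V = Sup {enat (card B) | B. lin_indep V B}"

section \<open>Bounded linear operators\<close>

text \<open>Only the values of an operator on the carrier of its domain are relevant.\<close>

definition bounded_ops ::
    "('k::real_normed_field, 'x) nvs \<Rightarrow> ('k, 'y) nvs \<Rightarrow> ('x \<Rightarrow> 'y) set" where
  "bounded_ops E F = {T. T \<in> carrier E \<rightarrow> carrier F \<and>
     (\<forall>u\<in>carrier E. \<forall>v\<in>carrier E. T (u \<oplus>\<^bsub>E\<^esub> v) = T u \<oplus>\<^bsub>F\<^esub> T v) \<and>
     (\<forall>c. \<forall>u\<in>carrier E. T (c \<odot>\<^bsub>E\<^esub> u) = c \<odot>\<^bsub>F\<^esub> T u) \<and>
     (\<exists>C. \<forall>u\<in>carrier E. vnorm F (T u) \<le> C * vnorm E u)}"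

definition op_norm :: "('k, 'x) nvs \<Rightarrow> ('k, 'y) nvs \<Rightarrow> ('x \<Rightarrow> 'y) \<Rightarrow> real" where
  "op_norm E F T = (SUP u\<in>{u \<in> carrier E. vnorm E u \<le> 1}. vnorm F (T u))"

section \<open>The pointwise Bishop-Phelps-Bollobas property\<close>

definition pointwise_BPB :: "('k::real_normed_field, 'x) nvs \<Rightarrow> ('k, 'y) nvs \<Rightarrow> bool" where
  "pointwise_BPB E F \<longleftrightarrow> (\<forall>\<epsilon>>0. \<exists>\<eta>>0. \<forall>T\<in>bounded_ops E F. \<forall>x\<^sub>0\<in>unit_sphere E.
     op_norm E F T = 1 \<and> vnorm F (T x\<^sub>0) > 1 - \<eta> \<longrightarrow>
     (\<exists>S\<in>bounded_ops E F. op_norm E F S = 1 \<and> vnorm F (S x\<^sub>0) = 1 \<and>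
        op_norm E F (\<lambda>x. S x \<ominus>\<^bsub>F\<^esub> T x) < \<epsilon>))"

text \<open>
  HOL cannot quantify over types inside a formula, so the type \<open>'y\<close> that supplies the elements of
  the range spaces is a parameter; the norm and the vector space operations on (a subset of) it are
  arbitrary. By the lemma \<open>universal_pointwise_BPB_domain_inj\<close> below, the property becomes stronger,
  and hence its negation weaker, as \<open>'y\<close> grows. The type \<open>nat \<Rightarrow> 'k\<close> already accommodates, up to
  isometric isomorphism, every separable Banach space.
\<close>

definition universal_pointwise_BPB_domain ::
    "'y itself \<Rightarrow> ('k::real_normed_field, 'x) nvs \<Rightarrow> bool" where
  "universal_pointwise_BPB_domain _ E \<longleftrightarrow>
     (\<forall>F :: ('k, 'y) nvs. banach_space F \<longrightarrow> pointwise_BPB E F)"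

lemma universal_pointwise_BPB_domain_inj:
  fixes E :: "('k::real_normed_field, 'x) nvs" and f :: "'z \<Rightarrow> 'y"
  assumes "inj f" and univ: "universal_pointwise_BPB_domain TYPE('y) E"
  shows "universal_pointwise_BPB_domain TYPE('z) E"
  unfolding universal_pointwise_BPB_domain_def
proof (intro allI impI)
  fix Z :: "('k, 'z) nvs"
  assume "banach_space Z"
  then interpret Z: banach_space Z .
  define g where "g = inv_into UNIV f"
  have gf [simp]: "g (f z) = z" for z
    using \<open>inj f\<close> by (simp add: g_def)
  define F :: "('k, 'y) nvs" where "F = \<lparr>carrier = f ` carrier Z, monoid.mult = undefined,
    one = undefined, ring.zero = f \<zero>\<^bsub>Z\<^esub>, add = (\<lambda>a b. f (g a \<oplus>\<^bsub>Z\<^esub> g b)),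
    smult = (\<lambda>c a. f (c \<odot>\<^bsub>Z\<^esub> g a)), vnorm = (\<lambda>a. vnorm Z (g a))\<rparr>"
  have F_simps [simp]: "carrier F = f ` carrier Z" "\<zero>\<^bsub>F\<^esub> = f \<zero>\<^bsub>Z\<^esub>"
    "a \<oplus>\<^bsub>F\<^esub> b = f (g a \<oplus>\<^bsub>Z\<^esub> g b)" "c \<odot>\<^bsub>F\<^esub> a = f (c \<odot>\<^bsub>Z\<^esub> g a)" "vnorm F a = vnorm Z (g a)"
    for a b c by (simp_all add: F_def)
  have scal [simp]: "carrier (ring_of_type_algebra :: 'k ring) = UNIV"
    by (simp add: ring_of_type_algebra_def)
  interpret F: abelian_group F
  proof (rule abelian_groupI, goal_cases)
    case (6 x)
    then obtain z where "z \<in> carrier Z" "x = f z" by auto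
    then show ?case
      by (intro bexI[of _ "f (\<ominus>\<^bsub>Z\<^esub> z)"]) (auto simp: Z.M.l_neg)
  qed (auto simp: Z.M.a_ac)
  have F_module: "Module.module (ring_of_type_algebra :: 'k ring) F"
    by (rule Module.moduleI)
      (auto simp: Z.smult_l_distr Z.smult_r_distr Z.smult_assoc1 F.abelian_group_axioms)
  have inv_eq: "\<ominus>\<^bsub>F\<^esub> (f b) = f (\<ominus>\<^bsub>Z\<^esub> b)" if "b \<in> carrier Z" for b
    using that by (intro F.minus_equality) (auto simp: Z.M.l_neg)
  have minus_eq [simp]: "f a \<ominus>\<^bsub>F\<^esub> f b = f (a \<ominus>\<^bsub>Z\<^esub> b)" if "b \<in> carrier Z" for a b
    using that by (simp add: a_minus_def inv_eq)
  have F_normed: "normed_space F"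
    by (intro normed_space.intro F_module normed_space_axioms.intro)
      (auto simp: Z.vnorm_nonneg Z.vnorm_eq_zero Z.vnorm_triangle Z.vnorm_smult inj_eq[OF \<open>inj f\<close>])
  have "banach_space F"
  proof (intro banach_space.intro F_normed banach_space_axioms.intro)
    fix s :: "nat \<Rightarrow> 'y"
    assume s: "\<And>n. s n \<in> carrier F"
      and cauchy: "\<And>e. e > 0 \<Longrightarrow> \<exists>N. \<forall>m\<ge>N. \<forall>n\<ge>N. vnorm F (s m \<ominus>\<^bsub>F\<^esub> s n) < e"
    define \<tau> where "\<tau> n = g (s n)" for n
    have \<tau>: "\<tau> n \<in> carrier Z" and s_eq: "s n = f (\<tau> n)" for n
      using s[of n] by (auto simp: \<tau>_def)
    have "\<exists>z\<in>carrier Z. (\<lambda>n. vnorm Z (\<tau> n \<ominus>\<^bsub>Z\<^esub> z)) \<longlonglongrightarrow> 0"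
      using cauchy \<tau> by (intro Z.complete) (auto simp: s_eq)
    then show "\<exists>y\<in>carrier F. (\<lambda>n. vnorm F (s n \<ominus>\<^bsub>F\<^esub> y)) \<longlonglongrightarrow> 0"
      by (auto simp: s_eq)
  qed
  then have BPB: "pointwise_BPB E F"
    using univ by (simp add: universal_pointwise_BPB_domain_def)
  have toF: "(\<lambda>x. f (T x)) \<in> bounded_ops E F" if "T \<in> bounded_ops E Z" for T
    using that by (auto simp: bounded_ops_def Pi_iff)
  have toZ: "(\<lambda>x. g (T x)) \<in> bounded_ops E Z \<and> (\<forall>x\<in>carrier E. f (g (T x)) = T x)"
    if T: "T \<in> bounded_ops E F" for T
  proof -
    have "g (T x) \<in> carrier Z" "f (g (T x)) = T x" if "x \<in> carrier E" for x
      using T that by (auto simp: bounded_ops_def Pi_iff dest!: bspec[where x = x])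
    with T show ?thesis
      by (auto simp: bounded_ops_def)
  qed
  show "pointwise_BPB E Z"
    unfolding pointwise_BPB_def
  proof (intro allI impI)
    fix \<epsilon> :: real
    assume "\<epsilon> > 0"
    then obtain \<eta> where "\<eta> > 0" and \<eta>: "\<And>T x. T \<in> bounded_ops E F \<Longrightarrow> x \<in> unit_sphere E \<Longrightarrow>
        op_norm E F T = 1 \<Longrightarrow> vnorm F (T x) > 1 - \<eta> \<Longrightarrow>
        \<exists>S\<in>bounded_ops E F. op_norm E F S = 1 \<and> vnorm F (S x) = 1 \<and>
          op_norm E F (\<lambda>x. S x \<ominus>\<^bsub>F\<^esub> T x) < \<epsilon>"
      using BPB unfolding pointwise_BPB_def by meson
    have "\<exists>S\<in>bounded_ops E Z. op_norm E Z S = 1 \<and> vnorm Z (S x) = 1 \<and>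
        op_norm E Z (\<lambda>x. S x \<ominus>\<^bsub>Z\<^esub> T x) < \<epsilon>"
      if T: "T \<in> bounded_ops E Z" and x: "x \<in> unit_sphere E"
        and Tx: "op_norm E Z T = 1" "vnorm Z (T x) > 1 - \<eta>" for T x
    proof -
      have "op_norm E F (\<lambda>x. f (T x)) = 1"
        using Tx by (simp add: op_norm_def)
      obtain S where S: "S \<in> bounded_ops E F" "op_norm E F S = 1" "vnorm F (S x) = 1"
          "op_norm E F (\<lambda>x. S x \<ominus>\<^bsub>F\<^esub> f (T x)) < \<epsilon>"
        using \<open>op_norm E F (\<lambda>x. f (T x)) = 1\<close> \<eta>[OF toF[OF T] x] Tx(2) by auto
      have "op_norm E F (\<lambda>x. S x \<ominus>\<^bsub>F\<^esub> f (T x)) = op_norm E Z (\<lambda>x. g (S x) \<ominus>\<^bsub>Z\<^esub> T x)"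
        unfolding op_norm_def
      proof (intro SUP_cong refl)
        fix u assume "u \<in> {u \<in> carrier E. vnorm E u \<le> 1}"
        then have "f (g (S u)) = S u" "T u \<in> carrier Z"
          using toZ[OF S(1)] T by (auto simp: bounded_ops_def)
        then show "vnorm F (S u \<ominus>\<^bsub>F\<^esub> f (T u)) = vnorm Z (g (S u) \<ominus>\<^bsub>Z\<^esub> T u)"
          by (metis F_simps(5) gf minus_eq)
      qed
      with S show ?thesis
        using toZ[OF S(1)] by (intro bexI[of _ "\<lambda>x. g (S x)"]) (auto simp: op_norm_def)
    qed
    with \<open>\<eta> > 0\<close> show "\<exists>\<eta>>0. \<forall>T\<in>bounded_ops E Z. \<forall>x\<^sub>0\<in>unit_sphere E.
        op_norm E Z T = 1 \<and> vnorm Z (T x\<^sub>0) > 1 - \<eta> \<longrightarrow>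
        (\<exists>S\<in>bounded_ops E Z. op_norm E Z S = 1 \<and> vnorm Z (S x\<^sub>0) = 1 \<and>
          op_norm E Z (\<lambda>x. S x \<ominus>\<^bsub>Z\<^esub> T x) < \<epsilon>)"
      by (intro exI[of _ \<eta>]) auto
  qed
qed

section \<open>The spaces $L_p(\mu)$\<close>

definition Lp_fun :: "real \<Rightarrow> 'a measure \<Rightarrow> ('a \<Rightarrow> 'k::real_normed_field) set" where
  "Lp_fun p M = {f \<in> borel_measurable M. integrable M (\<lambda>x. norm (f x) powr p)}"

definition ae_rel ::
    "real \<Rightarrow> 'a measure \<Rightarrow> (('a \<Rightarrow> 'k::real_normed_field) \<times> ('a \<Rightarrow> 'k)) set" where
  "ae_rel p M = {(f, g). f \<in> Lp_fun p M \<and> g \<in> Lp_fun p M \<and> (AE x in M. f x = g x)}"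

definition Lp_norm :: "real \<Rightarrow> 'a measure \<Rightarrow> ('a \<Rightarrow> 'k::real_normed_field) \<Rightarrow> real" where
  "Lp_norm p M f = (LINT x|M. norm (f x) powr p) powr (1 / p)"

text \<open>
  Elements are a.e.-equivalence classes. The operations are lifted from representatives; as these
  respect the relation, each union below is that of a single class.
\<close>

definition Lp :: "real \<Rightarrow> 'a measure \<Rightarrow> ('k::real_normed_field, ('a \<Rightarrow> 'k) set) nvs" where
  "Lp p M = \<lparr>
     carrier = Lp_fun p M // ae_rel p M,
     monoid.mult = undefined,
     one = undefined,
     ring.zero = ae_rel p M `` {\<lambda>_. 0},
     add = (\<lambda>A B. \<Union>f\<in>A. \<Union>g\<in>B. ae_rel p M `` {\<lambda>x. f x + g x}),
     smult = (\<lambda>c A. \<Union>f\<in>A. ae_rel p M `` {\<lambda>x. c * f x}),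
     vnorm = (\<lambda>A. the_elem (Lp_norm p M ` A))\<rparr>"

end

theory Submission
  imports Defs
begin

text \<open>
  The range space is \<open>Y = \<ell>\<^sub>\<infinity>\<close> with the norm \<open>max (Q y) (sup \<bar>y\<^sub>k\<bar>)\<close>, where
  \<open>Q y = (\<Sum>k. \<bar>y\<^sub>k\<bar>\<^sup>2 / 4\<^sup>k)\<^sup>1\<^sup>/\<^sup>2\<close> is Hilbertian. If \<open>dim L\<^sub>p(\<mu>) \<ge> 2\<close>, there are disjoint sets of positive
  finite measure, with normalized indicators \<open>e\<^sub>1, e\<^sub>2\<close> and dual functionals \<open>f, g\<close> of norm one. The
  operator \<open>T u = (1 - 4\<^sup>-\<^sup>n)\<^sup>1\<^sup>/\<^sup>2 f(u)\<close> (coordinate \<open>0\<close>) \<open>+ g(u)\<close> (coordinate \<open>n\<close>) has norm one and almost attains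
  it at \<open>e\<^sub>1\<close>. Suppose that \<open>S\<close> is of norm one, is close to \<open>T\<close> and attains its norm at \<open>e\<^sub>1\<close>. All
  coordinates of \<open>S e\<^sub>1\<close> but the first are small, so \<open>Q (S e\<^sub>1) = 1\<close>, and the parallelogram law gives
  \<open>a\<^sup>2 + b\<^sup>2 Q(S e\<^sub>2)\<^sup>2 \<le> 1\<close> whenever \<open>a\<^sup>p + b\<^sup>p = 1\<close>. As \<open>p > 2\<close>, letting \<open>b\<close> tend to \<open>0\<close> forces
  \<open>S e\<^sub>2 = 0\<close>, although \<open>T e\<^sub>2\<close> has norm one.
\<close>

section \<open>The range space\<close>

text \<open>This is \<open>Q\<close> of the overview. The weights are square summable, so the series
  converges for every bounded sequence; coordinate \<open>0\<close> has weight one.\<close>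

definition weighted_l2 :: "(nat \<Rightarrow> 'k::real_normed_vector) \<Rightarrow> real" where
  "weighted_l2 y = sqrt (\<Sum>k. (norm (y k) / 2 ^ k)\<^sup>2)"

text \<open>The two parts of the maximum have different tasks: the Hilbertian part supplies the
  parallelogram law, while the supremum lets a far coordinate, whose Hilbertian weight is tiny,
  still carry norm one.\<close>

definition renormed_linf :: "('k::real_normed_field, nat \<Rightarrow> 'k) nvs" where
  "renormed_linf = \<lparr>carrier = {y. bounded (range y)}, monoid.mult = undefined, one = undefined,
     ring.zero = (\<lambda>_. 0), add = (\<lambda>y z k. y k + z k), smult = (\<lambda>c y k. c * y k),
     vnorm = (\<lambda>y. max (weighted_l2 y) (SUP k. norm (y k)))\<rparr>"

lemma renormed_linf_simps [simp]:
  "carrier renormed_linf = {y. bounded (range y)}"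
  "\<zero>\<^bsub>renormed_linf\<^esub> = (\<lambda>_. 0)"
  "y \<oplus>\<^bsub>renormed_linf\<^esub> z = (\<lambda>k. y k + z k)"
  "c \<odot>\<^bsub>renormed_linf\<^esub> y = (\<lambda>k. c * y k)"
  by (simp_all add: renormed_linf_def)

lemma vnorm_renormed_linf:
  "vnorm renormed_linf y = max (weighted_l2 y) (SUP k. norm (y k))"
  by (simp add: renormed_linf_def)

section \<open>The Hilbertian norm on bounded sequences\<close>

lemma bdd_above_norm_range:
  "bounded (range y) \<Longrightarrow> bdd_above (range (\<lambda>k. norm (y k)))"
  by (auto simp: bounded_iff bdd_above_def)

lemma square_power_two: "(2 ^ k)\<^sup>2 = (4 :: real) ^ k"
  by (simp add: power2_eq_square flip: power_mult_distrib)

lemma summable_weighted: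
  fixes y :: "nat \<Rightarrow> 'k::real_normed_vector"
  assumes "bounded (range y)"
  shows "summable (\<lambda>k. (norm (y k) / 2 ^ k)\<^sup>2)"
proof -
  obtain B where B: "\<And>k. norm (y k) \<le> B"
    using assms by (auto simp: bounded_iff)
  have "summable (\<lambda>k. B\<^sup>2 * (1 / 4 :: real) ^ k)"
    by (intro summable_mult summable_geometric) simp
  moreover have "norm ((norm (y k) / 2 ^ k)\<^sup>2) \<le> B\<^sup>2 * (1 / 4) ^ k" for k
  proof -
    have "(norm (y k))\<^sup>2 \<le> B\<^sup>2"
      by (intro power_mono B) simp
    then show ?thesis
      by (simp add: power_divide square_power_two divide_right_mono)
  qed
  ultimately show ?thesis
    by (rule summable_comparison_test'[where N = 0])
qed

lemma weighted_l2_squared: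
  assumes "bounded (range y)"
  shows "(weighted_l2 y)\<^sup>2 = (\<Sum>k. (norm (y k) / 2 ^ k)\<^sup>2)"
  unfolding weighted_l2_def
  by (intro real_sqrt_pow2 suminf_nonneg summable_weighted assms) simp

lemma weighted_l2_nonneg: "bounded (range y) \<Longrightarrow> 0 \<le> weighted_l2 y"
  unfolding weighted_l2_def
  by (intro real_sqrt_ge_zero suminf_nonneg summable_weighted) simp_all

text \<open>A single term of a nonnegative series is at most its sum. The case \<open>k = 0\<close>,
  where the divisor is one, is what later confines the first coordinate of
  \<open>S e1\<close>.\<close>

lemma coordinate_le_weighted_l2:
  assumes "bounded (range y)"
  shows "norm (y k) / 2 ^ k \<le> weighted_l2 y"
proof -
  have "(norm (y k) / 2 ^ k)\<^sup>2 \<le> (weighted_l2 y)\<^sup>2"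
    unfolding weighted_l2_squared[OF assms]
    using sum_le_suminf[OF summable_weighted[OF assms], of "{k}"] by simp
  then show ?thesis
    by (rule power2_le_imp_le) (rule weighted_l2_nonneg[OF assms])
qed

text \<open>Finite sections make the Minkowski inequality for \<open>L2_set\<close> available;
  \<open>weighted_l2_triangle\<close> then follows in the limit.\<close>

lemma weighted_l2_LIMSEQ:
  assumes "bounded (range y)"
  shows "(\<lambda>n. L2_set (\<lambda>k. norm (y k) / 2 ^ k) {..<n}) \<longlonglongrightarrow> weighted_l2 y"
  unfolding weighted_l2_def L2_set_def
  by (intro tendsto_real_sqrt summable_LIMSEQ summable_weighted assms)

lemma bounded_range_add:
  fixes y z :: "nat \<Rightarrow> 'k::real_normed_vector"
  assumes "bounded (range y)" "bounded (range z)"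
  shows "bounded (range (\<lambda>k. y k + z k))"
  using bounded_plus_comp[OF assms] by simp

lemma bounded_range_diff:
  fixes y z :: "nat \<Rightarrow> 'k::real_normed_vector"
  assumes "bounded (range y)" "bounded (range z)"
  shows "bounded (range (\<lambda>k. y k - z k))"
  using bounded_minus_comp[OF assms] by simp

lemma bounded_range_mult:
  fixes y :: "nat \<Rightarrow> 'k::real_normed_field"
  assumes "bounded (range y)"
  shows "bounded (range (\<lambda>k. c * y k))"
proof -
  obtain B where B: "\<And>k. norm (y k) \<le> B"
    using assms by (auto simp: bounded_iff)
  show ?thesis
    by (rule boundedI[where B = "norm c * B"]) (auto simp: norm_mult intro!: mult_left_mono B)
qed

lemma weighted_l2_triangle:
  fixes y z :: "nat \<Rightarrow> 'k::real_normed_vector"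
  assumes "bounded (range y)" "bounded (range z)"
  shows "weighted_l2 (\<lambda>k. y k + z k) \<le> weighted_l2 y + weighted_l2 z"
proof (rule LIMSEQ_le)
  show "(\<lambda>n. L2_set (\<lambda>k. norm (y k + z k) / 2 ^ k) {..<n}) \<longlonglongrightarrow> weighted_l2 (\<lambda>k. y k + z k)"
    by (intro weighted_l2_LIMSEQ bounded_range_add assms)
  show "(\<lambda>n. L2_set (\<lambda>k. norm (y k) / 2 ^ k) {..<n} + L2_set (\<lambda>k. norm (z k) / 2 ^ k) {..<n})
      \<longlonglongrightarrow> weighted_l2 y + weighted_l2 z"
    by (intro tendsto_add weighted_l2_LIMSEQ assms)
  have "L2_set (\<lambda>k. norm (y k + z k) / 2 ^ k) {..<n}
      \<le> L2_set (\<lambda>k. norm (y k) / 2 ^ k) {..<n} + L2_set (\<lambda>k. norm (z k) / 2 ^ k) {..<n}" for n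
  proof -
    have "L2_set (\<lambda>k. norm (y k + z k) / 2 ^ k) {..<n}
        \<le> L2_set (\<lambda>k. norm (y k) / 2 ^ k + norm (z k) / 2 ^ k) {..<n}"
      by (intro L2_set_mono)
        (simp_all add: add_divide_distrib[symmetric] divide_right_mono norm_triangle_ineq)
    also have "\<dots> \<le> L2_set (\<lambda>k. norm (y k) / 2 ^ k) {..<n} + L2_set (\<lambda>k. norm (z k) / 2 ^ k) {..<n}"
      by (rule L2_set_triangle_ineq)
    finally show ?thesis .
  qed
  then show "\<exists>N. \<forall>n\<ge>N. L2_set (\<lambda>k. norm (y k + z k) / 2 ^ k) {..<n}
      \<le> L2_set (\<lambda>k. norm (y k) / 2 ^ k) {..<n} + L2_set (\<lambda>k. norm (z k) / 2 ^ k) {..<n}"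
    by blast
qed

lemma weighted_l2_mult:
  fixes y :: "nat \<Rightarrow> 'k::real_normed_field"
  assumes "bounded (range y)"
  shows "weighted_l2 (\<lambda>k. c * y k) = norm c * weighted_l2 y"
proof -
  have "(\<Sum>k. (norm (c * y k) / 2 ^ k)\<^sup>2) = (\<Sum>k. (norm c)\<^sup>2 * (norm (y k) / 2 ^ k)\<^sup>2)"
    by (simp add: norm_mult power_mult_distrib power_divide)
  also have "\<dots> = (norm c)\<^sup>2 * (\<Sum>k. (norm (y k) / 2 ^ k)\<^sup>2)"
    by (rule suminf_mult[OF summable_weighted[OF assms]])
  finally show ?thesis
    by (simp add: weighted_l2_def real_sqrt_mult)
qed

text \<open>The identity holds in each coordinate, because the absolute value of the scalars comes
  from a real inner product; it is then summed. For complex scalars the underlying real structure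
  suffices.\<close>

lemma weighted_l2_parallelogram:
  fixes y z :: "nat \<Rightarrow> 'k::real_inner"
  assumes "bounded (range y)" "bounded (range z)"
  shows "(weighted_l2 (\<lambda>k. y k + z k))\<^sup>2 + (weighted_l2 (\<lambda>k. y k - z k))\<^sup>2
    = 2 * (weighted_l2 y)\<^sup>2 + 2 * (weighted_l2 z)\<^sup>2"
proof -
  have diff: "bounded (range (\<lambda>k. y k - z k))"
    by (rule bounded_range_diff[OF assms])
  have "(norm (y k + z k) / 2 ^ k)\<^sup>2 + (norm (y k - z k) / 2 ^ k)\<^sup>2
      = 2 * (norm (y k) / 2 ^ k)\<^sup>2 + 2 * (norm (z k) / 2 ^ k)\<^sup>2" for k
    by (simp add: power_divide power2_norm_eq_inner inner_add inner_diff inner_commute field_simps)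
  then have "(\<Sum>k. (norm (y k + z k) / 2 ^ k)\<^sup>2 + (norm (y k - z k) / 2 ^ k)\<^sup>2)
      = (\<Sum>k. 2 * (norm (y k) / 2 ^ k)\<^sup>2 + 2 * (norm (z k) / 2 ^ k)\<^sup>2)"
    by simp
  moreover note summable_weighted[OF assms(1)] summable_weighted[OF assms(2)]
    summable_weighted[OF diff] summable_weighted[OF bounded_range_add[OF assms]]
  ultimately show ?thesis
    by (simp add: weighted_l2_squared assms diff bounded_range_add
        suminf_add[symmetric] suminf_mult summable_mult)
qed

section \<open>Equivalence with the supremum norm, and completeness\<close>

text \<open>The squared weights sum to 4/3, and 2 is a convenient upper bound for its square root.
  With \<open>coordinate_le_vnorm_renormed_linf\<close> this makes the norm equivalent to the
  supremum norm.\<close>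

lemma vnorm_renormed_linf_le:
  fixes y :: "nat \<Rightarrow> 'k::real_normed_field"
  assumes B: "\<And>k. norm (y k) \<le> B"
  shows "vnorm renormed_linf y \<le> 2 * B"
proof -
  have "0 \<le> B"
    using norm_ge_zero B by (rule order_trans)
  have bounded: "bounded (range y)"
    using B by (auto simp: bounded_iff)
  have "(norm (y k) / 2 ^ k)\<^sup>2 \<le> B\<^sup>2 * (1 / 4) ^ k" for k
  proof -
    have "(norm (y k))\<^sup>2 \<le> B\<^sup>2"
      by (intro power_mono B) simp
    then show ?thesis
      by (simp add: power_divide square_power_two divide_right_mono)
  qed
  then have "(weighted_l2 y)\<^sup>2 \<le> (\<Sum>k. B\<^sup>2 * (1 / 4) ^ k)"
    unfolding weighted_l2_squared[OF bounded]
    by (intro suminf_le summable_weighted bounded summable_mult summable_geometric) simp_all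
  also have "\<dots> = B\<^sup>2 * (4 / 3)"
    by (subst suminf_mult) (simp_all add: suminf_geometric summable_geometric)
  also have "\<dots> \<le> (2 * B)\<^sup>2"
    by (simp add: power_mult_distrib)
  finally have "weighted_l2 y \<le> 2 * B"
    by (rule power2_le_imp_le) (use \<open>0 \<le> B\<close> in simp)
  moreover have "(SUP k. norm (y k)) \<le> 2 * B"
    using B \<open>0 \<le> B\<close> by (intro cSUP_least) (auto intro: order_trans[OF B])
  ultimately show ?thesis
    by (simp add: vnorm_renormed_linf)
qed

lemma coordinate_le_vnorm_renormed_linf:
  assumes "bounded (range y)"
  shows "norm (y k) \<le> vnorm renormed_linf y"
  using cSUP_upper[OF _ bdd_above_norm_range[OF assms], of k] by (simp add: vnorm_renormed_linf max.coboundedI2)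

lemma renormed_linf_abelian_group:
  "abelian_group (renormed_linf :: ('k::real_normed_field, nat \<Rightarrow> 'k) nvs)"
proof (rule abelian_groupI, goal_cases)
  case (6 y)
  then show ?case
    by (intro bexI[of _ "\<lambda>k. - 1 * y k"]) (auto intro: bounded_range_mult)
qed (auto simp: add_ac bounded_range_add)

lemma renormed_linf_minus:
  fixes y z :: "nat \<Rightarrow> 'k::real_normed_field"
  assumes "bounded (range z)"
  shows "y \<ominus>\<^bsub>renormed_linf\<^esub> z = (\<lambda>k. y k - z k)"
proof -
  interpret abelian_group "renormed_linf :: ('k, nat \<Rightarrow> 'k) nvs"
    by (rule renormed_linf_abelian_group)
  have "\<ominus>\<^bsub>renormed_linf\<^esub> z = (\<lambda>k. - z k)"
    using assms bounded_range_mult[of z "- 1"] by (intro minus_equality) auto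
  then show ?thesis
    by (simp add: a_minus_def)
qed

lemma renormed_linf_normed_space:
  "normed_space (renormed_linf :: ('k::real_normed_field, nat \<Rightarrow> 'k) nvs)"
proof (intro normed_space.intro normed_space_axioms.intro)
  show "Module.module (ring_of_type_algebra :: 'k ring) (renormed_linf :: ('k, nat \<Rightarrow> 'k) nvs)"
    by (rule Module.moduleI[OF cring_from_type_algebra renormed_linf_abelian_group])
      (auto simp: ring_of_type_algebra_def algebra_simps bounded_range_mult)
next
  fix x y :: "nat \<Rightarrow> 'k" and c :: 'k
  assume x: "x \<in> carrier renormed_linf"
  then have x': "bounded (range x)"
    by simp
  show "0 \<le> vnorm renormed_linf x"
    using weighted_l2_nonneg[OF x'] by (simp add: vnorm_renormed_linf max.coboundedI1)
  show "vnorm renormed_linf x = 0 \<longleftrightarrow> x = \<zero>\<^bsub>renormed_linf\<^esub>"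
  proof
    assume "vnorm renormed_linf x = 0"
    then have "norm (x k) \<le> 0" for k
      using coordinate_le_vnorm_renormed_linf[OF x'] by metis
    then show "x = \<zero>\<^bsub>renormed_linf\<^esub>"
      by (auto simp: fun_eq_iff)
  qed (simp add: vnorm_renormed_linf weighted_l2_def)
  have sup_mult: "(SUP k. norm (c * x k)) = norm c * (SUP k. norm (x k))"
  proof (cases "c = 0")
    case False
    show ?thesis
    proof (intro antisym cSUP_least)
      show "norm (c * x k) \<le> norm c * (SUP k. norm (x k))" for k
        by (auto simp: norm_mult intro!: mult_left_mono cSUP_upper bdd_above_norm_range x')
      \<comment> \<open>The reverse inequality comes from dividing each coordinate by
        \<open>norm c\<close>, hence the case distinction on \<open>c = 0\<close>.\<close>
      have "(SUP k. norm (x k)) \<le> (SUP k. norm (c * x k)) / norm c"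
      proof (rule cSUP_least)
        show "norm (x k) \<le> (SUP k. norm (c * x k)) / norm c" for k
          using cSUP_upper[OF _ bdd_above_norm_range[OF bounded_range_mult[OF x', of c]], of k] False
          by (simp add: norm_mult field_simps)
      qed simp
      then show "norm c * (SUP k. norm (x k)) \<le> (SUP k. norm (c * x k))"
        using False by (simp add: field_simps)
    qed simp
  qed simp
  show "vnorm renormed_linf (c \<odot>\<^bsub>renormed_linf\<^esub> x) = norm c * vnorm renormed_linf x"
    by (simp add: vnorm_renormed_linf weighted_l2_mult x' sup_mult max_mult_distrib_left)
  assume "y \<in> carrier renormed_linf"
  then have y': "bounded (range y)"
    by simp
  have "weighted_l2 (\<lambda>k. x k + y k) \<le> vnorm renormed_linf x + vnorm renormed_linf y"
    by (rule order_trans[OF weighted_l2_triangle[OF x' y']]) (simp add: vnorm_renormed_linf add_mono)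
  moreover have "(SUP k. norm (x k + y k)) \<le> vnorm renormed_linf x + vnorm renormed_linf y"
    by (intro cSUP_least order_trans[OF norm_triangle_ineq] add_mono
        coordinate_le_vnorm_renormed_linf x' y') simp
  ultimately show "vnorm renormed_linf (x \<oplus>\<^bsub>renormed_linf\<^esub> y)
      \<le> vnorm renormed_linf x + vnorm renormed_linf y"
    by (simp add: vnorm_renormed_linf)
qed

text \<open>By the equivalence with the supremum norm, a Cauchy sequence is uniformly Cauchy in its
  coordinates, and its uniform limit is bounded and is also the limit in the norm.\<close>

lemma renormed_linf_banach_space:
  "banach_space (renormed_linf :: ('k::{real_normed_field, banach}, nat \<Rightarrow> 'k) nvs)"
proof (intro banach_space.intro renormed_linf_normed_space banach_space_axioms.intro)
  fix s :: "nat \<Rightarrow> nat \<Rightarrow> 'k"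
  assume s: "\<And>n. s n \<in> carrier renormed_linf"
    and cauchy: "\<And>e. e > 0 \<Longrightarrow>
      \<exists>N. \<forall>m\<ge>N. \<forall>n\<ge>N. vnorm renormed_linf (s m \<ominus>\<^bsub>renormed_linf\<^esub> s n) < e"
  have sb: "bounded (range (s n))" for n
    using s by simp
  have "uniformly_convergent_on UNIV s"
    unfolding uniformly_convergent_eq_Cauchy uniformly_Cauchy_on_def
  proof (intro allI impI)
    fix e :: real
    assume "e > 0"
    then obtain N where N: "\<And>m n. m \<ge> N \<Longrightarrow> n \<ge> N \<Longrightarrow>
        vnorm renormed_linf (s m \<ominus>\<^bsub>renormed_linf\<^esub> s n) < e"
      using cauchy by blast
    have "dist (s m k) (s n k) < e" if "m \<ge> N" "n \<ge> N" for m n k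
    proof -
      have "norm (s m k - s n k) \<le> vnorm renormed_linf (\<lambda>k. s m k - s n k)"
        by (rule coordinate_le_vnorm_renormed_linf) (rule bounded_range_diff[OF sb sb])
      also have "\<dots> < e"
        using N[OF that] by (simp add: renormed_linf_minus sb)
      finally show ?thesis
        by (simp add: dist_norm)
    qed
    then show "\<exists>M. \<forall>x\<in>UNIV. \<forall>m\<ge>M. \<forall>n\<ge>M. dist (s m x) (s n x) < e"
      by blast
  qed
  then obtain l where l: "uniform_limit UNIV s l sequentially"
    by (auto simp: uniformly_convergent_on_def)
  have "bounded (range l)"
  proof -
    obtain n where n: "\<And>k. dist (s n k) (l k) < 1"
      using uniform_limitD[OF l zero_less_one] by (auto simp: eventually_sequentially)
    obtain B where "\<And>k. norm (s n k) \<le> B"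
      using sb[of n] by (auto simp: bounded_iff)
    then have "norm (l k) \<le> B + 1" for k
      using n[of k] norm_triangle_ineq2[of "l k" "s n k"]
      by (smt (verit) dist_norm norm_minus_commute)
    then show ?thesis
      by (auto simp: bounded_iff)
  qed
  moreover have "(\<lambda>n. vnorm renormed_linf (s n \<ominus>\<^bsub>renormed_linf\<^esub> l)) \<longlonglongrightarrow> 0"
  proof (rule tendstoI)
    fix e :: real
    assume "e > 0"
    \<comment> \<open>A coordinate error of \<open>e / 4\<close> costs at most \<open>e / 2\<close>
      in the norm, which keeps the final inequality strict.\<close>
    then have "\<forall>\<^sub>F n in sequentially. \<forall>k. dist (s n k) (l k) < e / 4"
      using uniform_limitD[OF l, of "e / 4"] by simp
    then show "\<forall>\<^sub>F n in sequentially. dist (vnorm renormed_linf (s n \<ominus>\<^bsub>renormed_linf\<^esub> l)) 0 < e"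
    proof eventually_elim
      case (elim n)
      then have le: "norm (s n k - l k) \<le> e / 4" for k
        by (simp add: dist_norm less_imp_le)
      interpret normed_space "renormed_linf :: ('k, nat \<Rightarrow> 'k) nvs"
        by (rule renormed_linf_normed_space)
      have "0 \<le> vnorm renormed_linf (\<lambda>k. s n k - l k)"
        using bounded_range_diff[OF sb \<open>bounded (range l)\<close>] by (intro vnorm_nonneg) simp
      moreover have "vnorm renormed_linf (\<lambda>k. s n k - l k) \<le> 2 * (e / 4)"
        by (rule vnorm_renormed_linf_le[OF le])
      ultimately show ?case
        using \<open>e > 0\<close> \<open>bounded (range l)\<close>
        by (simp add: renormed_linf_minus)
    qed
  qed
  ultimately show "\<exists>x\<in>carrier renormed_linf.
      (\<lambda>n. vnorm renormed_linf (s n \<ominus>\<^bsub>renormed_linf\<^esub> x)) \<longlonglongrightarrow> 0"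
    by (intro bexI[of _ l]) simp_all
qed

section \<open>Operators attaining their norm at a flat point\<close>

text \<open>The quantitative core is \<open>(weighted_l2 v)\<^sup>2 \<le> b powr (p - 2)\<close> for
  all \<open>b\<close> in (0,1). The left side does not depend on \<open>b\<close>, and the right
  side tends to zero with \<open>b\<close> since \<open>p > 2\<close>.\<close>

lemma weighted_l2_flat_imp_zero:
  fixes u v :: "nat \<Rightarrow> 'k::{real_normed_field, real_inner}"
  assumes p: "2 < p" and bounded: "bounded (range u)" "bounded (range v)"
    and u: "weighted_l2 u = 1"
    and flat: "\<And>a b. norm a powr p + norm b powr p \<le> 1 \<Longrightarrow> weighted_l2 (\<lambda>k. a * u k + b * v k) \<le> 1"
  shows "v k = 0"
proof -
  have bound: "(weighted_l2 v)\<^sup>2 \<le> b powr (p - 2)" if b: "0 < b" "b < 1" for b :: real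
  proof -
    \<comment> \<open>The largest admissible \<open>a\<close>: it satisfies
      \<open>a powr p + b powr p = 1\<close>.\<close>
    define a where "a = (1 - b powr p) powr (1 / p)"
    have "b powr p < 1"
      using b p powr_less_mono2[of p b 1] by simp
    then have "a powr p = 1 - b powr p"
      using p by (simp add: a_def powr_powr)
    have "0 \<le> a"
      by (simp add: a_def)
    let ?x = "\<lambda>k. of_real a * u k" and ?y = "\<lambda>k. of_real b * v k"
    have xy: "bounded (range ?x)" "bounded (range ?y)"
      by (intro bounded_range_mult bounded)+
    \<comment> \<open>The hypothesis \<open>flat\<close> sees only absolute values of the scalars,
      so it applies to both signs of \<open>b\<close>.\<close>
    have "weighted_l2 (\<lambda>k. ?x k + ?y k) \<le> 1" "weighted_l2 (\<lambda>k. ?x k - ?y k) \<le> 1"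
      using flat[of "of_real a" "of_real b"] flat[of "of_real a" "- of_real b"]
        \<open>a powr p = 1 - b powr p\<close> \<open>0 \<le> a\<close> b by simp_all
    then have "(weighted_l2 (\<lambda>k. ?x k + ?y k))\<^sup>2 + (weighted_l2 (\<lambda>k. ?x k - ?y k))\<^sup>2 \<le> 1 + 1"
      by (intro add_mono power_le_one weighted_l2_nonneg bounded_range_add bounded_range_diff xy)
    then have "a\<^sup>2 + b\<^sup>2 * (weighted_l2 v)\<^sup>2 \<le> 1"
      unfolding weighted_l2_parallelogram[OF xy]
      by (simp add: weighted_l2_mult bounded u power_mult_distrib)
    moreover have "1 - b powr p \<le> a\<^sup>2"
    proof -
      \<comment> \<open>The base is at most one, so lowering the exponent from 1 to
        \<open>2 / p\<close> increases the power.\<close>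
      have "(1 - b powr p) powr 1 \<le> (1 - b powr p) powr (2 / p)"
        using \<open>b powr p < 1\<close> p b by (intro powr_mono') auto
      also have "\<dots> = a\<^sup>2"
        using \<open>b powr p < 1\<close> by (simp add: a_def powr_powr flip: powr_numeral)
      finally show ?thesis
        using \<open>b powr p < 1\<close> by simp
    qed
    ultimately have "b\<^sup>2 * (weighted_l2 v)\<^sup>2 \<le> b powr p"
      by linarith
    also have "\<dots> = b\<^sup>2 * b powr (p - 2)"
      using b by (simp flip: powr_numeral powr_add)
    finally show ?thesis
      using b by simp
  qed
  have "weighted_l2 v = 0"
  proof (rule ccontr)
    let ?q = "(weighted_l2 v)\<^sup>2"
    assume "weighted_l2 v \<noteq> 0"
    then have q: "0 < ?q"
      by simp
    \<comment> \<open>This choice makes \<open>b powr (p - 2)\<close> at most half of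
      \<open>?q\<close>; the bound 1/2 keeps \<open>b\<close> below one.\<close>
    define b where "b = min (1 / 2) ((?q / 2) powr (1 / (p - 2)))"
    have "0 < b" "b < 1"
      using q by (auto simp: b_def)
    then have "?q \<le> b powr (p - 2)"
      by (rule bound)
    also have "\<dots> \<le> ((?q / 2) powr (1 / (p - 2))) powr (p - 2)"
      using p \<open>0 < b\<close> by (intro powr_mono2) (auto simp: b_def)
    also have "\<dots> = ?q / 2"
      using p q by (simp add: powr_powr)
    finally show False
      using q by simp
  qed
  then show ?thesis
    using coordinate_le_weighted_l2[OF bounded(2), of k] by (simp add: field_simps)
qed

text \<open>\<open>op_norm\<close> is a supremum of reals, which is an upper bound only if the set
  is bounded above; \<open>C\<close> supplies that bound and does not enter the conclusion.\<close>

lemma le_op_norm: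
  assumes "\<And>u. u \<in> carrier E \<Longrightarrow> vnorm E u \<le> 1 \<Longrightarrow> vnorm F (T u) \<le> C"
    and "u \<in> carrier E" "vnorm E u \<le> 1"
  shows "vnorm F (T u) \<le> op_norm E F T"
  unfolding op_norm_def using assms by (intro cSUP_upper) (auto simp: bdd_above_def)

lemma bounded_ops_bound:
  assumes "T \<in> bounded_ops E F" "\<And>u. u \<in> carrier E \<Longrightarrow> 0 \<le> vnorm E u"
  obtains C where "\<And>u. u \<in> carrier E \<Longrightarrow> vnorm E u \<le> 1 \<Longrightarrow> vnorm F (T u) \<le> C"
proof -
  obtain C where C: "\<And>u. u \<in> carrier E \<Longrightarrow> vnorm F (T u) \<le> C * vnorm E u"
    using assms(1) unfolding bounded_ops_def by blast
  have "vnorm F (T u) \<le> \<bar>C\<bar>" if "u \<in> carrier E" "vnorm E u \<le> 1" for u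
  proof -
    have "C * vnorm E u \<le> \<bar>C\<bar> * 1"
      using assms(2)[OF that(1)] that by (intro mult_mono) auto
    with C[OF that(1)] show ?thesis
      by simp
  qed
  then show ?thesis
    by (rule that)
qed

lemma weighted_l2_two_coordinates:
  fixes a b :: "'k::real_normed_field"
  assumes "0 < n"
  shows "weighted_l2 (\<lambda>k. if k = 0 then a else if k = n then b else 0)
    = sqrt ((norm a)\<^sup>2 + (norm b / 2 ^ n)\<^sup>2)"
proof -
  have "(\<Sum>k. (norm (if k = 0 then a else if k = n then b else 0) / 2 ^ k)\<^sup>2)
      = (\<Sum>k\<in>{0, n}. (norm (if k = 0 then a else if k = n then b else 0) / 2 ^ k)\<^sup>2)"
    by (rule suminf_finite) auto
  with assms show ?thesis
    by (simp add: weighted_l2_def)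
qed

lemma bounded_range_two_coordinates:
  fixes a b :: "'k::real_normed_vector"
  shows "bounded (range (\<lambda>k::nat. if k = 0 then a else if k = n then b else 0))"
  by (rule boundedI[where B = "max (norm a) (norm b)"]) (auto simp: le_max_iff_disj)

section \<open>Failure of the pointwise property for an abstract domain\<close>

text \<open>The domain enters only through two unit vectors whose span obeys an upper
  \<open>p\<close>-estimate and through biorthogonal functionals of norm at most one. Thus only
  these facts have to be checked for \<open>Lp\<close>.\<close>

lemma not_pointwise_BPB_renormed_linf:
  fixes E :: "('k::{real_normed_field, real_inner}, 'x) nvs"
  assumes p: "2 < p"
    and add_closed: "\<And>u v. u \<in> carrier E \<Longrightarrow> v \<in> carrier E \<Longrightarrow> u \<oplus>\<^bsub>E\<^esub> v \<in> carrier E"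
    and smult_closed: "\<And>c u. u \<in> carrier E \<Longrightarrow> c \<odot>\<^bsub>E\<^esub> u \<in> carrier E"
    and e: "e1 \<in> unit_sphere E" "e2 \<in> unit_sphere E"
    and flat: "\<And>a b. norm a powr p + norm b powr p \<le> 1 \<Longrightarrow>
      vnorm E (a \<odot>\<^bsub>E\<^esub> e1 \<oplus>\<^bsub>E\<^esub> b \<odot>\<^bsub>E\<^esub> e2) \<le> 1"
    and f_add: "\<And>u v. u \<in> carrier E \<Longrightarrow> v \<in> carrier E \<Longrightarrow> f (u \<oplus>\<^bsub>E\<^esub> v) = f u + f v"
    and f_smult: "\<And>c u. u \<in> carrier E \<Longrightarrow> f (c \<odot>\<^bsub>E\<^esub> u) = c * f u"
    and f_bound: "\<And>u. u \<in> carrier E \<Longrightarrow> norm (f u) \<le> vnorm E u"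
    and g_add: "\<And>u v. u \<in> carrier E \<Longrightarrow> v \<in> carrier E \<Longrightarrow> g (u \<oplus>\<^bsub>E\<^esub> v) = g u + g v"
    and g_smult: "\<And>c u. u \<in> carrier E \<Longrightarrow> g (c \<odot>\<^bsub>E\<^esub> u) = c * g u"
    and g_bound: "\<And>u. u \<in> carrier E \<Longrightarrow> norm (g u) \<le> vnorm E u"
    and vals: "f e1 = 1" "g e1 = 0" "f e2 = 0" "g e2 = 1"
  shows "\<not> pointwise_BPB E (renormed_linf :: ('k, nat \<Rightarrow> 'k) nvs)"
proof
  let ?Y = "renormed_linf :: ('k, nat \<Rightarrow> 'k) nvs"
  interpret Y: normed_space ?Y
    by (rule renormed_linf_normed_space)
  have ec: "e1 \<in> carrier E" "e2 \<in> carrier E" "vnorm E e1 = 1" "vnorm E e2 = 1"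
    using e by (auto simp: unit_sphere_def)
  have E_nonneg: "0 \<le> vnorm E u" if "u \<in> carrier E" for u
    using norm_ge_zero f_bound[OF that] by (rule order_trans)
  \<comment> \<open>The value 1/2 serves twice: it keeps all later coordinates of
    \<open>S e1\<close> away from one, and it keeps coordinate \<open>n\<close> of
    \<open>S e2\<close> away from zero.\<close>
  define \<epsilon> :: real where "\<epsilon> = 1 / 2"
  have "0 < \<epsilon>"
    by (simp add: \<epsilon>_def)
  moreover assume "pointwise_BPB E ?Y"
  ultimately obtain \<eta> where "0 < \<eta>" and \<eta>: "\<And>T x. T \<in> bounded_ops E ?Y \<Longrightarrow> x \<in> unit_sphere E \<Longrightarrow>
      op_norm E ?Y T = 1 \<Longrightarrow> vnorm ?Y (T x) > 1 - \<eta> \<Longrightarrow>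
      \<exists>S\<in>bounded_ops E ?Y. op_norm E ?Y S = 1 \<and> vnorm ?Y (S x) = 1 \<and>
        op_norm E ?Y (\<lambda>x. S x \<ominus>\<^bsub>?Y\<^esub> T x) < \<epsilon>"
    unfolding pointwise_BPB_def by meson
  obtain m where m: "(1 / 4) ^ m < min \<eta> 1"
    using real_arch_pow_inv[of "min \<eta> 1" "1 / 4"] \<open>0 < \<eta>\<close> by auto
  \<comment> \<open>The successor ensures that coordinate \<open>n\<close> is different from
    coordinate \<open>0\<close>.\<close>
  define n where "n = Suc m"
  have n: "(1 / 4) ^ n < \<eta>" "(1 / 4 :: real) ^ n < 1" "0 < n"
  proof -
    have "(1 / 4 :: real) ^ n \<le> (1 / 4) ^ m"
      by (rule power_decreasing) (simp_all add: n_def)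
    with m show "(1 / 4) ^ n < \<eta>" "(1 / 4 :: real) ^ n < 1"
      by linarith+
  qed (simp add: n_def)
  \<comment> \<open>The squared weight of coordinate \<open>n\<close> is \<open>(1 / 4) ^ n\<close>,
    so \<open>\<alpha>\<^sup>2\<close> and this weight add up to one and the Hilbertian part of
    \<open>T\<close> is contractive. Moreover
    \<open>1 - \<alpha> \<le> 1 - \<alpha>\<^sup>2 < \<eta>\<close>.\<close>
  define \<alpha> where "\<alpha> = sqrt (1 - (1 / 4) ^ n)"
  have \<alpha>: "0 \<le> \<alpha>" "\<alpha>\<^sup>2 = 1 - (1 / 4) ^ n" "\<alpha> > 1 - \<eta>"
  proof -
    show "0 \<le> \<alpha>" and sq: "\<alpha>\<^sup>2 = 1 - (1 / 4) ^ n"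
      using n by (simp_all add: \<alpha>_def)
    have "\<alpha> \<le> 1"
      by (simp add: \<alpha>_def)
    then have "\<alpha>\<^sup>2 \<le> \<alpha>"
      using \<open>0 \<le> \<alpha>\<close> by (simp add: power2_eq_square mult_left_le)
    then show "\<alpha> > 1 - \<eta>"
      using sq n by simp
  qed
  define T where "T u = (\<lambda>k. if k = 0 then of_real \<alpha> * f u else if k = n then g u else 0)" for u
  have T_carrier: "bounded (range (T u))" for u
    unfolding T_def by (rule bounded_range_two_coordinates)
  have T_bound: "vnorm ?Y (T u) \<le> vnorm E u" if "u \<in> carrier E" for u
  proof -
    have "\<alpha> * norm (f u) \<le> 1 * vnorm E u"
      using f_bound[OF that] by (intro mult_mono) (auto simp: \<alpha>_def)
    then have "norm (T u k) \<le> vnorm E u" for k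
      using g_bound[OF that] E_nonneg[OF that] \<open>0 \<le> \<alpha>\<close> by (auto simp: T_def norm_mult)
    then have sup: "(SUP k. norm (T u k)) \<le> vnorm E u"
      by (intro cSUP_least) auto
    have "(\<alpha> * norm (f u))\<^sup>2 + (norm (g u) / 2 ^ n)\<^sup>2
        = \<alpha>\<^sup>2 * (norm (f u))\<^sup>2 + (1 / 4) ^ n * (norm (g u))\<^sup>2"
      by (simp add: power_mult_distrib power_divide square_power_two)
    also have "\<dots> \<le> \<alpha>\<^sup>2 * (vnorm E u)\<^sup>2 + (1 / 4) ^ n * (vnorm E u)\<^sup>2"
      using f_bound[OF that] g_bound[OF that] by (intro add_mono mult_left_mono power_mono) auto
    also have "\<dots> = (vnorm E u)\<^sup>2"
      unfolding \<alpha> by (simp add: algebra_simps)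
    finally have "weighted_l2 (T u) \<le> vnorm E u"
      unfolding T_def weighted_l2_two_coordinates[OF \<open>0 < n\<close>]
      using E_nonneg[OF that] \<open>0 \<le> \<alpha>\<close> by (intro real_le_lsqrt) (simp_all add: norm_mult)
    with sup show ?thesis
      by (simp add: vnorm_renormed_linf)
  qed
  have T: "T \<in> bounded_ops E ?Y"
  proof -
    have "\<exists>C. \<forall>u\<in>carrier E. vnorm ?Y (T u) \<le> C * vnorm E u"
      using T_bound by (intro exI[of _ 1]) simp
    moreover have "T \<in> carrier E \<rightarrow> carrier ?Y"
      by (simp add: T_carrier)
    ultimately show ?thesis
      by (auto simp: bounded_ops_def T_def f_add g_add f_smult g_smult fun_eq_iff distrib_left)
  qed
  \<comment> \<open>Coordinate \<open>n\<close> of \<open>T e2\<close> is one, so the supremum part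
    of the norm detects it at full size.\<close>
  have T_e2: "1 \<le> vnorm ?Y (T e2)"
    using coordinate_le_vnorm_renormed_linf[OF T_carrier, of e2 n] n by (simp add: T_def vals)
  have "op_norm E ?Y T = 1"
  proof (rule antisym)
    show "op_norm E ?Y T \<le> 1"
      unfolding op_norm_def using ec by (intro cSUP_least) (auto intro: order_trans[OF T_bound])
    show "1 \<le> op_norm E ?Y T"
      using T_e2 le_op_norm[of E ?Y T 1 e2] ec by (force intro: order_trans[OF T_bound])
  qed
  moreover have "vnorm ?Y (T e1) > 1 - \<eta>"
    using coordinate_le_vnorm_renormed_linf[OF T_carrier, of e1 0] \<alpha> by (simp add: T_def vals)
  ultimately obtain S where S: "S \<in> bounded_ops E ?Y" "op_norm E ?Y S = 1" "vnorm ?Y (S e1) = 1"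
      "op_norm E ?Y (\<lambda>x. S x \<ominus>\<^bsub>?Y\<^esub> T x) < \<epsilon>"
    using \<eta>[OF T e(1)] by blast
  have S_carrier: "bounded (range (S u))" if "u \<in> carrier E" for u
    using S(1) that by (auto simp: bounded_ops_def)
  have S_add: "S (u \<oplus>\<^bsub>E\<^esub> v) = (\<lambda>k. S u k + S v k)" if "u \<in> carrier E" "v \<in> carrier E" for u v
    using S(1) that by (auto simp: bounded_ops_def)
  have S_smult: "S (c \<odot>\<^bsub>E\<^esub> u) = (\<lambda>k. c * S u k)" if "u \<in> carrier E" for u c
    using S(1) that by (auto simp: bounded_ops_def)
  obtain C where C: "\<And>u. u \<in> carrier E \<Longrightarrow> vnorm E u \<le> 1 \<Longrightarrow> vnorm ?Y (S u) \<le> C"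
    using bounded_ops_bound[OF S(1) E_nonneg] by blast
  have S_le: "vnorm ?Y (S u) \<le> 1" if "u \<in> carrier E" "vnorm E u \<le> 1" for u
    using le_op_norm[where T = S, OF C that] S(2) by simp
  have near: "norm (S u k - T u k) < 1 / 2" if u: "u \<in> carrier E" "vnorm E u \<le> 1" for u k
  proof -
    have diff: "S v \<ominus>\<^bsub>?Y\<^esub> T v = (\<lambda>k. S v k - T v k)" for v
      by (rule renormed_linf_minus[OF T_carrier])
    \<comment> \<open>The constant serves only to bound the supremum in \<open>op_norm\<close>: the
      coordinates of the difference are at most 2, and passing to the norm costs another factor
      2.\<close>
    have "vnorm ?Y (S v \<ominus>\<^bsub>?Y\<^esub> T v) \<le> 2 * 2" if v: "v \<in> carrier E" "vnorm E v \<le> 1" for v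
      unfolding diff
    proof (rule vnorm_renormed_linf_le)
      fix k
      have "norm (S v k) \<le> 1"
        using coordinate_le_vnorm_renormed_linf[OF S_carrier[OF v(1)], of k] S_le[OF v] by linarith
      moreover have "norm (T v k) \<le> 1"
        using coordinate_le_vnorm_renormed_linf[OF T_carrier, of v k] T_bound[OF v(1)] v(2) by linarith
      ultimately show "norm (S v k - T v k) \<le> 2"
        using norm_triangle_ineq4[of "S v k" "T v k"] by linarith
    qed
    from le_op_norm[of E ?Y "\<lambda>v. S v \<ominus>\<^bsub>?Y\<^esub> T v", OF this u]
    have "vnorm ?Y (\<lambda>k. S u k - T u k) < 1 / 2"
      using S(4) by (simp add: diff \<epsilon>_def)
    then show ?thesis
      using coordinate_le_vnorm_renormed_linf[OF bounded_range_diff[OF S_carrier[OF u(1)] T_carrier], of k u]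
      by linarith
  qed
  \<comment> \<open>If the Hilbertian part were below one, so would be the supremum: coordinate
    \<open>0\<close> is at most \<open>weighted_l2 (S e1)\<close>, and the others are below 1/2
    because \<open>T e1\<close> vanishes there.\<close>
  have "weighted_l2 (S e1) = 1"
  proof (rule antisym)
    show "weighted_l2 (S e1) \<le> 1"
      using S(3) by (simp add: vnorm_renormed_linf)
    show "1 \<le> weighted_l2 (S e1)"
    proof (rule ccontr)
      assume less: "\<not> 1 \<le> weighted_l2 (S e1)"
      have "norm (S e1 k) \<le> max (weighted_l2 (S e1)) (1 / 2)" for k
      proof (cases "k = 0")
        case True
        then show ?thesis
          using coordinate_le_weighted_l2[OF S_carrier[OF ec(1)], of 0] by simp
      next
        case False
        then have "T e1 k = 0"
          by (simp add: T_def vals)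
        then show ?thesis
          using near[OF ec(1), of k] ec by simp
      qed
      then have "(SUP k. norm (S e1 k)) \<le> max (weighted_l2 (S e1)) (1 / 2)"
        by (intro cSUP_least) auto
      with less have "vnorm ?Y (S e1) < 1"
        by (simp add: vnorm_renormed_linf)
      with S(3) show False
        by simp
    qed
  qed
  then have "S e2 n = 0"
  proof (rule weighted_l2_flat_imp_zero[OF p S_carrier S_carrier, rotated 2])
    fix a b :: 'k
    assume ab: "norm a powr p + norm b powr p \<le> 1"
    have "S (a \<odot>\<^bsub>E\<^esub> e1 \<oplus>\<^bsub>E\<^esub> b \<odot>\<^bsub>E\<^esub> e2) = (\<lambda>k. a * S e1 k + b * S e2 k)"
      by (simp add: S_add S_smult smult_closed ec)
    with S_le[OF add_closed[OF smult_closed smult_closed] flat[OF ab]]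
    show "weighted_l2 (\<lambda>k. a * S e1 k + b * S e2 k) \<le> 1"
      by (simp add: ec vnorm_renormed_linf)
  qed (rule ec)+
  \<comment> \<open>Coordinate \<open>n\<close> of \<open>T e2\<close> is \<open>g e2 = 1\<close>,
    at distance one from that of \<open>S e2\<close>.\<close>
  then show False
    using near[OF ec(2), of n] ec n by (simp add: T_def vals)
qed

section \<open>The vector space structure of $L_p(\mu)$\<close>

text \<open>A sum is at most twice the larger summand in absolute value. This crude bound gives
  integrability for every \<open>p > 0\<close>, without Minkowski's inequality.\<close>

lemma Lp_fun_add:
  fixes f g :: "'a \<Rightarrow> 'k::{real_normed_field, second_countable_topology}"
  assumes "0 < p" "f \<in> Lp_fun p M" "g \<in> Lp_fun p M"
  shows "(\<lambda>x. f x + g x) \<in> Lp_fun p M"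
proof -
  have [measurable]: "f \<in> borel_measurable M" "g \<in> borel_measurable M"
    using assms by (auto simp: Lp_fun_def)
  have "integrable M (\<lambda>x. norm (f x + g x) powr p)"
  proof (rule Bochner_Integration.integrable_bound)
    show "integrable M (\<lambda>x. 2 powr p * (norm (f x) powr p + norm (g x) powr p))"
      using assms by (auto simp: Lp_fun_def)
    show "AE x in M. norm (norm (f x + g x) powr p)
        \<le> norm (2 powr p * (norm (f x) powr p + norm (g x) powr p))"
    proof (rule AE_I2)
      fix x
      have "norm (f x + g x) powr p \<le> (2 * max (norm (f x)) (norm (g x))) powr p"
        using norm_triangle_ineq[of "f x" "g x"] assms(1) by (intro powr_mono2) auto
      also have "\<dots> = 2 powr p * max (norm (f x)) (norm (g x)) powr p"
        by (rule powr_mult)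
      also have "\<dots> \<le> 2 powr p * (norm (f x) powr p + norm (g x) powr p)"
        by (intro mult_left_mono) (auto simp: max_def)
      finally show "norm (norm (f x + g x) powr p)
          \<le> norm (2 powr p * (norm (f x) powr p + norm (g x) powr p))"
        by simp
    qed
  qed measurable
  then show ?thesis
    by (simp add: Lp_fun_def)
qed

lemma Lp_fun_mult:
  fixes f :: "'a \<Rightarrow> 'k::{real_normed_field, second_countable_topology}"
  assumes "f \<in> Lp_fun p M"
  shows "(\<lambda>x. c * f x) \<in> Lp_fun p M"
  using assms by (auto simp: Lp_fun_def norm_mult powr_mult)

lemma Lp_fun_zero: "(\<lambda>_. 0) \<in> Lp_fun p M"
  by (simp add: Lp_fun_def)

lemma equiv_ae_rel: "equiv (Lp_fun p M) (ae_rel p M)"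
proof (rule equivI)
  show "trans (ae_rel p M)"
    by (rule transI) (auto simp: ae_rel_def elim: eventually_elim2)
  show "sym (ae_rel p M)"
    by (rule symI) (auto simp: ae_rel_def eq_commute)
qed (auto simp: ae_rel_def refl_on_def)

lemma ae_class_eq_iff:
  "f \<in> Lp_fun p M \<Longrightarrow> g \<in> Lp_fun p M \<Longrightarrow>
    ae_rel p M `` {f} = ae_rel p M `` {g} \<longleftrightarrow> (AE x in M. f x = g x)"
  by (subst eq_equiv_class_iff[OF equiv_ae_rel]) (auto simp: ae_rel_def)

lemma in_carrier_Lp: "f \<in> Lp_fun p M \<Longrightarrow> ae_rel p M `` {f} \<in> carrier (Lp p M)"
  by (simp add: Lp_def quotientI)

lemma carrier_LpE:
  assumes "u \<in> carrier (Lp p M)"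
  obtains f where "f \<in> Lp_fun p M" "u = ae_rel p M `` {f}"
  using assms by (auto simp: Lp_def elim: quotientE)

lemma zero_Lp: "\<zero>\<^bsub>Lp p M\<^esub> = ae_rel p M `` {\<lambda>_. 0}"
  by (simp add: Lp_def)

lemma add_Lp:
  fixes f g :: "'a \<Rightarrow> 'k::{real_normed_field, second_countable_topology}"
  assumes "0 < p" "f \<in> Lp_fun p M" "g \<in> Lp_fun p M"
  shows "ae_rel p M `` {f} \<oplus>\<^bsub>Lp p M\<^esub> ae_rel p M `` {g} = ae_rel p M `` {\<lambda>x. f x + g x}"
proof -
  have "(\<lambda>f g. ae_rel p M `` {\<lambda>x. f x + g x :: 'k}) respects2 ae_rel p M"
  proof (rule congruent2I[OF equiv_ae_rel equiv_ae_rel])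
    fix f g h :: "'a \<Rightarrow> 'k"
    assume "h \<in> Lp_fun p M" "(f, g) \<in> ae_rel p M"
    then show "ae_rel p M `` {\<lambda>x. f x + h x} = ae_rel p M `` {\<lambda>x. g x + h x}"
      by (subst ae_class_eq_iff) (auto simp: ae_rel_def Lp_fun_add[OF assms(1)])
  next
    fix f g h :: "'a \<Rightarrow> 'k"
    assume "h \<in> Lp_fun p M" "(f, g) \<in> ae_rel p M"
    then show "ae_rel p M `` {\<lambda>x. h x + f x} = ae_rel p M `` {\<lambda>x. h x + g x}"
      by (subst ae_class_eq_iff) (auto simp: ae_rel_def Lp_fun_add[OF assms(1)])
  qed
  from UN_equiv_class2[OF equiv_ae_rel equiv_ae_rel this assms(2,3)] show ?thesis
    by (simp add: Lp_def)
qed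

lemma smult_Lp:
  fixes f :: "'a \<Rightarrow> 'k::{real_normed_field, second_countable_topology}"
  assumes "f \<in> Lp_fun p M"
  shows "c \<odot>\<^bsub>Lp p M\<^esub> ae_rel p M `` {f} = ae_rel p M `` {\<lambda>x. c * f x}"
proof -
  have "(\<lambda>f. ae_rel p M `` {\<lambda>x. c * f x}) respects ae_rel p M"
  proof (rule congruentI)
    fix f g :: "'a \<Rightarrow> 'k"
    assume "(f, g) \<in> ae_rel p M"
    then show "ae_rel p M `` {\<lambda>x. c * f x} = ae_rel p M `` {\<lambda>x. c * g x}"
      by (subst ae_class_eq_iff) (auto simp: ae_rel_def Lp_fun_mult)
  qed
  from UN_equiv_class[OF equiv_ae_rel this assms] show ?thesis
    by (simp add: Lp_def)
qed

text \<open>The norm is constant on a class, so its image is a singleton and \<open>the_elem\<close>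
  returns the intended value.\<close>

lemma vnorm_Lp:
  fixes f :: "'a \<Rightarrow> 'k::{real_normed_field, second_countable_topology}"
  assumes "f \<in> Lp_fun p M"
  shows "vnorm (Lp p M) (ae_rel p M `` {f}) = Lp_norm p M f"
proof -
  have "Lp_norm p M g = Lp_norm p M f" if "g \<in> ae_rel p M `` {f}" for g
  proof -
    have [measurable]: "f \<in> borel_measurable M" "g \<in> borel_measurable M"
      using that by (auto simp: ae_rel_def Lp_fun_def)
    have "AE x in M. norm (g x) powr p = norm (f x) powr p"
      using that by (auto simp: ae_rel_def)
    then have "(LINT x|M. norm (g x) powr p) = (LINT x|M. norm (f x) powr p)"
      by (intro integral_cong_AE) simp_all
    then show ?thesis
      by (simp add: Lp_norm_def)
  qed
  moreover have "f \<in> ae_rel p M `` {f}"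
    by (rule equiv_class_self[OF equiv_ae_rel assms])
  ultimately have "Lp_norm p M ` (ae_rel p M `` {f}) = {Lp_norm p M f}"
    by blast
  then show ?thesis
    by (simp add: Lp_def)
qed

text \<open>This gives access to the rules for finite sums, in terms of which
  \<open>lin_indep\<close> is stated.\<close>

lemma abelian_monoid_Lp:
  assumes "0 < p"
  shows "abelian_monoid
    (Lp p M :: ('k::{real_normed_field, second_countable_topology}, ('a \<Rightarrow> 'k) set) nvs)"
  by (rule abelian_monoidI)
    (auto elim!: carrier_LpE simp: zero_Lp add_Lp[OF assms] in_carrier_Lp Lp_fun_add[OF assms]
      Lp_fun_zero add_ac)

lemma smult_closed_Lp:
  fixes u :: "('a \<Rightarrow> 'k::{real_normed_field, second_countable_topology}) set"
  shows "u \<in> carrier (Lp p M) \<Longrightarrow> c \<odot>\<^bsub>Lp p M\<^esub> u \<in> carrier (Lp p M)"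
  by (auto elim!: carrier_LpE simp: smult_Lp in_carrier_Lp Lp_fun_mult)

lemma vdim_ge_2_imp_independent_pair:
  fixes V :: "('k::real_normed_field, 'v) nvs"
  assumes "abelian_monoid V" "vdim V \<ge> 2"
    and closed: "\<And>c u. u \<in> carrier V \<Longrightarrow> c \<odot>\<^bsub>V\<^esub> u \<in> carrier V"
    and zero: "\<And>u. u \<in> carrier V \<Longrightarrow> 0 \<odot>\<^bsub>V\<^esub> u = \<zero>\<^bsub>V\<^esub>"
  obtains u v where "u \<in> carrier V" "v \<in> carrier V"
    "\<And>c d. c \<odot>\<^bsub>V\<^esub> u \<oplus>\<^bsub>V\<^esub> d \<odot>\<^bsub>V\<^esub> v = \<zero>\<^bsub>V\<^esub> \<Longrightarrow> c = 0 \<and> d = 0"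
proof -
  interpret abelian_monoid V by fact
  obtain B where B: "lin_indep V B" "card B \<ge> 2"
  proof (rule ccontr)
    assume "\<not> thesis"
    then have "card B \<le> 1" if "lin_indep V B" for B
      using that \<open>\<And>B. lin_indep V B \<Longrightarrow> 2 \<le> card B \<Longrightarrow> thesis\<close> by fastforce
    then have "vdim V \<le> enat 1"
      unfolding vdim_def by (intro Sup_least) auto
    with assms(2) have "(2::enat) \<le> enat 1"
      by (rule order_trans)
    then show False
      by (simp add: numeral_eq_enat)
  qed
  have fin: "finite B" and BV: "B \<subseteq> carrier V"
    using B by (auto simp: lin_indep_def)
  obtain u v where uv: "u \<in> B" "v \<in> B" "u \<noteq> v"
  proof -
    have "\<not> card B \<le> Suc 0"
      using B(2) by simp
    then show thesis
      unfolding card_le_Suc0_iff_eq[OF fin] using that by blast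
  qed
  show ?thesis
  proof (rule that)
    show uvV: "u \<in> carrier V" "v \<in> carrier V"
      using uv BV by auto
    fix c d
    assume cd: "c \<odot>\<^bsub>V\<^esub> u \<oplus>\<^bsub>V\<^esub> d \<odot>\<^bsub>V\<^esub> v = \<zero>\<^bsub>V\<^esub>"
    \<comment> \<open>A relation between \<open>u\<close> and \<open>v\<close> is extended by zero
      coefficients to one on all of \<open>B\<close>.\<close>
    define k where "k w = (if w = u then c else if w = v then d else 0)" for w
    define B' where "B' = B - {u, v}"
    have B': "B = insert u (insert v B')" "finite B'" "B' \<subseteq> carrier V" "u \<notin> B'" "v \<notin> B'"
      using uv fin BV by (auto simp: B'_def)
    have "(\<Oplus>\<^bsub>V\<^esub>w\<in>B'. k w \<odot>\<^bsub>V\<^esub> w) = \<zero>\<^bsub>V\<^esub>"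
      using B' by (intro add.finprod_one_eqI) (auto simp: k_def zero)
    moreover have "(\<Oplus>\<^bsub>V\<^esub>w\<in>insert v B'. k w \<odot>\<^bsub>V\<^esub> w)
        = k v \<odot>\<^bsub>V\<^esub> v \<oplus>\<^bsub>V\<^esub> (\<Oplus>\<^bsub>V\<^esub>w\<in>B'. k w \<odot>\<^bsub>V\<^esub> w)"
      by (rule finsum_insert) (use B' uvV closed in auto)
    moreover have "(\<Oplus>\<^bsub>V\<^esub>w\<in>insert u (insert v B'). k w \<odot>\<^bsub>V\<^esub> w)
        = k u \<odot>\<^bsub>V\<^esub> u \<oplus>\<^bsub>V\<^esub> (\<Oplus>\<^bsub>V\<^esub>w\<in>insert v B'. k w \<odot>\<^bsub>V\<^esub> w)"
      by (rule finsum_insert) (use B' uv uvV closed in auto)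
    ultimately have "(\<Oplus>\<^bsub>V\<^esub>w\<in>B. k w \<odot>\<^bsub>V\<^esub> w) = \<zero>\<^bsub>V\<^esub>"
      using uv uvV cd closed by (simp add: B'(1) k_def)
    then have "\<forall>w\<in>B. k w = 0"
      using B(1) by (simp add: lin_indep_def)
    then show "c = 0 \<and> d = 0"
      using uv by (auto simp: k_def split: if_splits)
  qed
qed

section \<open>Norm-one functionals and disjoint sets\<close>

text \<open>On a set of finite measure, \<open>t \<le> 1 + t powr p\<close> provides an integrable
  majorant.\<close>

lemma Lp_fun_integrable_on:
  fixes f :: "'a \<Rightarrow> 'k::{real_normed_field, banach, second_countable_topology}"
  assumes p: "1 \<le> p" and f: "f \<in> Lp_fun p M" and A: "A \<in> sets M" "emeasure M A < \<infinity>"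
  shows "integrable M (\<lambda>x. indicator A x *\<^sub>R f x)"
proof (rule Bochner_Integration.integrable_bound)
  have [measurable]: "f \<in> borel_measurable M" "A \<in> sets M"
    using f A by (auto simp: Lp_fun_def)
  show "integrable M (\<lambda>x. indicator A x + norm (f x) powr p)"
    using f A by (auto simp: Lp_fun_def)
  show "AE x in M. norm (indicator A x *\<^sub>R f x) \<le> norm (indicator A x + norm (f x) powr p)"
  proof (rule AE_I2)
    fix x
    have "norm (f x) \<le> 1 + norm (f x) powr p"
    proof (cases "norm (f x) \<le> 1")
      case False
      then have "norm (f x) powr 1 \<le> norm (f x) powr p"
        using p by (intro powr_mono) auto
      with False show ?thesis
        by simp
    qed (simp add: add_increasing2)
    then show "norm (indicator A x *\<^sub>R f x) \<le> norm (indicator A x + norm (f x) powr p)"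
      by (auto simp: indicator_def)
  qed
  show "(\<lambda>x. indicator A x *\<^sub>R f x) \<in> borel_measurable M"
    by measurable
qed

text \<open>The factor makes this a norm-one functional, dual to \<open>unit_indicator\<close> below.\<close>

definition Lp_mean :: "real \<Rightarrow> 'a measure \<Rightarrow> 'a set \<Rightarrow>
    ('a \<Rightarrow> 'k::{real_normed_field, banach, second_countable_topology}) \<Rightarrow> 'k" where
  "Lp_mean p M A f = (measure M A powr (1 / p - 1)) *\<^sub>R (LINT x|M. indicator A x *\<^sub>R f x)"

lemma measure_pos:
  "0 < emeasure M A \<Longrightarrow> emeasure M A < \<infinity> \<Longrightarrow> 0 < measure M A"
  by (simp add: measure_def enn2real_positive_iff)

text \<open>This is Hoelder's inequality against an indicator, obtained by integrating a suitably
  scaled Young inequality over \<open>A\<close>.\<close>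

lemma norm_Lp_mean_le:
  fixes f :: "'a \<Rightarrow> 'k::{real_normed_field, banach, second_countable_topology}"
  assumes p: "1 < p" and f: "f \<in> Lp_fun p M"
    and A: "A \<in> sets M" "0 < emeasure M A" "emeasure M A < \<infinity>"
  shows "norm (Lp_mean p M A f) \<le> Lp_norm p M f"
proof -
  have [measurable]: "f \<in> borel_measurable M" "A \<in> sets M"
    using f A by (auto simp: Lp_fun_def)
  define m where "m = measure M A"
  have "0 < m"
    using A by (simp add: m_def measure_pos)
  define J where "J = (LINT x|M. norm (f x) powr p)"
  have int: "integrable M (\<lambda>x. norm (f x) powr p)"
    using f by (simp add: Lp_fun_def)
  have intA: "integrable M (\<lambda>x. indicator A x *\<^sub>R f x)"
    using p by (intro Lp_fun_integrable_on[OF _ f] A) simp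
  have "0 \<le> J"
    unfolding J_def by (intro integral_nonneg_AE) simp
  show ?thesis
  proof (cases "J = 0")
    case True
    then have "AE x in M. norm (f x) powr p = 0"
      unfolding J_def using int by (subst (asm) integral_nonneg_eq_0_iff_AE) auto
    then have "AE x in M. indicator A x *\<^sub>R f x = 0"
      by eventually_elim (simp add: powr_eq_0_iff)
    then have "Lp_mean p M A f = 0"
      by (simp add: Lp_mean_def integral_eq_zero_AE)
    then show ?thesis
      by (simp add: Lp_norm_def)
  next
    case False
    with \<open>0 \<le> J\<close> have "0 < J"
      by simp
    define s where "s = J powr (1 / p)"
    have s: "0 < s" "s powr p = J"
      using \<open>0 < J\<close> p by (simp_all add: s_def powr_powr)
    \<comment> \<open>The constant function \<open>c\<close> on \<open>A\<close> has the same
      \<open>p\<close>-norm as \<open>f\<close>. Young's inequality is an equality at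
      \<open>t = c\<close>, so nothing is lost in the extremal case.\<close>
    define c where "c = s * m powr (- 1 / p)"
    have c: "0 < c" "c powr p = J / m"
    proof -
      have "(m powr (- 1 / p)) powr p = m powr (- 1)"
        using p by (simp add: powr_powr)
      then have "c powr p = J * m powr (- 1)"
        unfolding c_def powr_mult by (simp only: s)
      then show "c powr p = J / m"
        using \<open>0 < m\<close> by (simp add: powr_minus_divide)
    qed (use s \<open>0 < m\<close> in \<open>simp add: c_def\<close>)
    have young: "t \<le> c * (t powr p * (m / J) / p + (1 - 1 / p))" if "0 \<le> t" for t
    proof -
      have "(t / c) * 1 \<le> (t / c) powr p / p + 1 powr (p / (p - 1)) / (p / (p - 1))"
        using p c that by (intro Youngs_inequality) (auto simp: field_simps)
      also have "\<dots> = t powr p * (m / J) / p + (1 - 1 / p)"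
        using p c that by (simp add: powr_divide field_simps)
      finally show ?thesis
        using c by (simp add: field_simps)
    qed
    have "norm (LINT x|M. indicator A x *\<^sub>R f x) \<le> (LINT x|M. norm (indicator A x *\<^sub>R f x))"
      by (rule integral_norm_bound)
    also have "\<dots> \<le> (LINT x|M. c * (m / J) / p * (norm (f x) powr p)
        + c * (1 - 1 / p) * indicator A x)"
    proof (rule integral_mono)
      fix x
      have "0 \<le> c * (m / J) / p * (norm (f x) powr p)"
        using c \<open>0 < m\<close> \<open>0 < J\<close> p by simp
      then show "norm (indicator A x *\<^sub>R f x)
          \<le> c * (m / J) / p * (norm (f x) powr p) + c * (1 - 1 / p) * indicator A x"
        using young[of "norm (f x)"] by (auto simp: indicator_def algebra_simps)
    qed (use int A integrable_norm[OF intA] in auto)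
    also have "\<dots> = c * (m / J) / p * J + c * (1 - 1 / p) * m"
      using int A by (simp add: J_def m_def)
    also have "\<dots> = c * m"
      using \<open>0 < J\<close> p by (simp add: field_simps)
    finally have "norm (Lp_mean p M A f) \<le> m powr (1 / p - 1) * (c * m)"
      by (simp add: Lp_mean_def m_def mult_left_mono)
    also have "\<dots> = s * (m powr (1 / p - 1) * m powr (- 1 / p) * m powr 1)"
      using \<open>0 < m\<close> by (simp add: c_def)
    also have "\<dots> = s"
      using \<open>0 < m\<close> by (simp flip: powr_add)
    finally show ?thesis
      by (simp add: Lp_norm_def s_def J_def)
  qed
qed

section \<open>Existence of two disjoint sets of positive finite measure\<close>

text \<open>Markov's inequality. It replaces sigma-finiteness: an \<open>Lp\<close> function lives
  on countably many sets of finite measure.\<close>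

lemma emeasure_superlevel_finite:
  fixes h :: "'a \<Rightarrow> 'k::real_normed_field"
  assumes h: "h \<in> Lp_fun p M" and "0 < c"
  shows "{x \<in> space M. c \<le> norm (h x) powr p} \<in> sets M"
    and "emeasure M {x \<in> space M. c \<le> norm (h x) powr p} < \<infinity>"
proof -
  have int: "integrable M (\<lambda>x. norm (h x) powr p)"
    using h by (simp add: Lp_fun_def)
  then have [measurable]: "(\<lambda>x. norm (h x) powr p) \<in> borel_measurable M"
    by (rule borel_measurable_integrable)
  show sets: "{x \<in> space M. c \<le> norm (h x) powr p} \<in> sets M"
    by measurable
  let ?S = "{x \<in> space M. c \<le> norm (h x) powr p}"
  have "ennreal c * emeasure M ?S = (\<integral>\<^sup>+x. ennreal c * indicator ?S x \<partial>M)"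
    by (rule nn_integral_cmult_indicator[OF sets, symmetric])
  also have "\<dots> \<le> (\<integral>\<^sup>+x. ennreal (norm (h x) powr p) \<partial>M)"
    by (intro nn_integral_mono) (auto simp: indicator_def)
  also have "\<dots> < \<infinity>"
    using int by (simp add: nn_integral_eq_integral)
  finally show "emeasure M ?S < \<infinity>"
    using \<open>0 < c\<close> by (auto simp: ennreal_mult_less_top)
qed

text \<open>By \<open>off\<close>, \<open>h\<close> vanishes almost everywhere outside
  \<open>A\<close>. By \<open>atom\<close>, each real component of \<open>h\<close> has one sign
  almost everywhere on \<open>A\<close>, and then its vanishing integral forces it to be
  zero.\<close>

lemma AE_zero_if_atomic:
  fixes h :: "'a \<Rightarrow> 'k::{real_normed_field, euclidean_space}"
  assumes p: "1 \<le> p" and h: "h \<in> Lp_fun p M" and A: "A \<in> sets M" "emeasure M A < \<infinity>"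
    and off: "\<And>C. C \<in> sets M \<Longrightarrow> emeasure M C < \<infinity> \<Longrightarrow> C \<inter> A = {} \<Longrightarrow> emeasure M C = 0"
    and atom: "\<And>C D. C \<in> sets M \<Longrightarrow> D \<in> sets M \<Longrightarrow> C \<subseteq> A \<Longrightarrow> D \<subseteq> A \<Longrightarrow> C \<inter> D = {} \<Longrightarrow>
      emeasure M C = 0 \<or> emeasure M D = 0"
    and zero: "(LINT x|M. indicator A x *\<^sub>R h x) = 0"
  shows "AE x in M. h x = 0"
proof -
  have [measurable]: "h \<in> borel_measurable M" "A \<in> sets M"
    using h A by (auto simp: Lp_fun_def)
  have int: "integrable M (\<lambda>x. indicator A x *\<^sub>R h x)"
    by (rule Lp_fun_integrable_on[OF p h A])
  \<comment> \<open>The thresholds \<open>1 / Suc n\<close> exhaust the set where \<open>h\<close>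
    is nonzero, and each superlevel set has finite measure.\<close>
  have "AE x in M. x \<notin> {x \<in> space M. 1 / Suc n \<le> norm (h x) powr p} - A" for n
  proof (rule AE_not_in)
    let ?S = "{x \<in> space M. 1 / Suc n \<le> norm (h x) powr p}"
    have S: "?S \<in> sets M" "emeasure M ?S < \<infinity>"
      using emeasure_superlevel_finite[OF h, of "1 / Suc n"] by simp_all
    then have "emeasure M (?S - A) < \<infinity>"
      using emeasure_mono[of "?S - A" ?S M] by (auto intro: order_le_less_trans)
    then have "emeasure M (?S - A) = 0"
      using S by (intro off) auto
    then show "?S - A \<in> null_sets M"
      using S by (intro null_setsI) auto
  qed
  then have "AE x in M. \<forall>n. x \<notin> {x \<in> space M. 1 / Suc n \<le> norm (h x) powr p} - A"
    by (subst AE_all_countable) simp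
  then have outside: "AE x in M. x \<notin> A \<longrightarrow> h x = 0"
    using AE_space
  proof eventually_elim
    case (elim x)
    show ?case
    proof (intro impI, rule ccontr)
      assume "x \<notin> A" "h x \<noteq> 0"
      then obtain n where "inverse (Suc n) < norm (h x) powr p"
        using reals_Archimedean[of "norm (h x) powr p"] by auto
      with elim \<open>x \<notin> A\<close> show False
        by (auto simp: inverse_eq_divide dest!: spec[of _ n])
    qed
  qed
  have inside: "AE x in M. indicator A x *\<^sub>R h x \<bullet> b = 0" for b :: 'k
  proof -
    let ?k = "\<lambda>x. (indicator A x *\<^sub>R h x) \<bullet> b"
    have k: "integrable M ?k" "integral\<^sup>L M ?k = 0"
    proof -
      show "integrable M ?k"
        using int by (rule integrable_inner_left)
      have "integral\<^sup>L M ?k = (LINT x|M. indicator A x *\<^sub>R h x) \<bullet> b"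
        using int by (rule integral_inner_left)
      then show "integral\<^sup>L M ?k = 0"
        using zero by simp
    qed
    have [measurable]: "?k \<in> borel_measurable M"
      using k by (intro borel_measurable_integrable)
    have sets: "{x \<in> space M. 0 < ?k x} \<in> sets M" "{x \<in> space M. ?k x < 0} \<in> sets M"
      by measurable
    \<comment> \<open>The indicator makes \<open>?k\<close> vanish outside \<open>A\<close>, so
      these are two disjoint subsets of \<open>A\<close>.\<close>
    have "emeasure M {x \<in> space M. 0 < ?k x} = 0 \<or> emeasure M {x \<in> space M. ?k x < 0} = 0"
      using sets by (rule atom) (auto simp: indicator_def split: if_splits)
    then show ?thesis
    proof
      assume "emeasure M {x \<in> space M. 0 < ?k x} = 0"
      then have "AE x in M. x \<notin> {x \<in> space M. 0 < ?k x}"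
        using sets by (intro AE_not_in null_setsI)
      then have "AE x in M. 0 \<le> - ?k x"
        using AE_space by eventually_elim auto
      moreover have "integrable M (\<lambda>x. - ?k x)" "(LINT x|M. - ?k x) = 0"
        using k by simp_all
      ultimately show ?thesis
        by (subst (asm) integral_nonneg_eq_0_iff_AE) auto
    next
      assume "emeasure M {x \<in> space M. ?k x < 0} = 0"
      then have "AE x in M. x \<notin> {x \<in> space M. ?k x < 0}"
        using sets by (intro AE_not_in null_setsI)
      then have "AE x in M. 0 \<le> ?k x"
        using AE_space by eventually_elim auto
      with k show ?thesis
        by (subst (asm) integral_nonneg_eq_0_iff_AE) auto
    qed
  qed
  have "AE x in M. \<forall>b\<in>Basis. indicator A x *\<^sub>R h x \<bullet> b = 0"
    by (rule AE_finite_allI[OF finite_Basis inside])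
  with outside show ?thesis
  proof eventually_elim
    case (elim x)
    then show ?case
      by (cases "x \<in> A") (auto intro: euclidean_eqI)
  qed
qed

text \<open>Without such sets, a function in \<open>Lp\<close> is determined almost everywhere by
  its integral over a single set, which leaves room for at most one dimension.\<close>

lemma disjoint_positive_sets:
  fixes f g :: "'a \<Rightarrow> 'k::{real_normed_field, euclidean_space}"
  assumes p: "1 \<le> p" and f: "f \<in> Lp_fun p M" and g: "g \<in> Lp_fun p M"
    and indep: "\<And>c d. AE x in M. c * f x + d * g x = 0 \<Longrightarrow> c = 0 \<and> d = 0"
  obtains A B where "A \<in> sets M" "0 < emeasure M A" "emeasure M A < \<infinity>"
    "B \<in> sets M" "0 < emeasure M B" "emeasure M B < \<infinity>" "A \<inter> B = {}"
proof (rule ccontr)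
  note witness = that
  assume "\<not> thesis"
  then have none: "emeasure M A = 0 \<or> emeasure M B = 0"
    if "A \<in> sets M" "emeasure M A < \<infinity>" "B \<in> sets M" "emeasure M B < \<infinity>" "A \<inter> B = {}" for A B
    using that witness by (meson not_gr_zero)
  obtain A where A: "A \<in> sets M" "emeasure M A < \<infinity>"
    and off: "\<And>C. C \<in> sets M \<Longrightarrow> emeasure M C < \<infinity> \<Longrightarrow> C \<inter> A = {} \<Longrightarrow> emeasure M C = 0"
  \<comment> \<open>Any set of positive finite measure will do. If there is none, all sets of finite
    measure are null and the empty set works.\<close>
  proof (cases "\<exists>A\<in>sets M. 0 < emeasure M A \<and> emeasure M A < \<infinity>")
    case True
    then obtain A where "A \<in> sets M" "0 < emeasure M A" "emeasure M A < \<infinity>"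
      by blast
    moreover have "emeasure M C = 0" if "C \<in> sets M" "emeasure M C < \<infinity>" "C \<inter> A = {}" for C
      using none[of C A] that \<open>A \<in> sets M\<close> \<open>0 < emeasure M A\<close> \<open>emeasure M A < \<infinity>\<close> by auto
    ultimately show thesis
      by (intro that[of A])
  next
    case False
    then show thesis
      by (intro that[of "{}"]) (auto simp: not_less)
  qed
  have zero: "AE x in M. h x = 0" if "h \<in> Lp_fun p M" "(LINT x|M. indicator A x *\<^sub>R h x) = 0"
    for h :: "'a \<Rightarrow> 'k"
  proof (rule AE_zero_if_atomic[OF p that(1) A off _ that(2)])
    fix C D
    assume CD: "C \<in> sets M" "D \<in> sets M" "C \<subseteq> A" "D \<subseteq> A" "C \<inter> D = {}"
    then have "emeasure M C < \<infinity>" "emeasure M D < \<infinity>"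
      using A by (auto intro: order_le_less_trans[OF emeasure_mono])
    with CD show "emeasure M C = 0 \<or> emeasure M D = 0"
      by (intro none)
  qed
  define c where "c = (LINT x|M. indicator A x *\<^sub>R f x)"
  define d where "d = (LINT x|M. indicator A x *\<^sub>R g x)"
  have int: "integrable M (\<lambda>x. indicator A x *\<^sub>R f x)" "integrable M (\<lambda>x. indicator A x *\<^sub>R g x)"
    by (intro Lp_fun_integrable_on[OF p _ A] f g)+
  \<comment> \<open>The coefficients are the integrals of \<open>g\<close> and \<open>f\<close> over
    \<open>A\<close>, crosswise and with opposite signs, so that the integral of the combination
    cancels.\<close>
  have "(LINT x|M. indicator A x *\<^sub>R (d * f x + - c * g x))
      = (LINT x|M. d * (indicator A x *\<^sub>R f x) - c * (indicator A x *\<^sub>R g x))"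
    by (simp add: algebra_simps)
  also have "\<dots> = (LINT x|M. d * (indicator A x *\<^sub>R f x)) - (LINT x|M. c * (indicator A x *\<^sub>R g x))"
    by (intro Bochner_Integration.integral_diff integrable_mult_right int)
  also have "\<dots> = 0"
    by (simp only: integral_mult_right_zero flip: c_def d_def) simp
  finally have "d = 0 \<and> - c = 0"
    using p by (intro indep zero Lp_fun_add Lp_fun_mult f g) simp
  \<comment> \<open>Since \<open>c = 0\<close>, the integral of \<open>f\<close> itself over
    \<open>A\<close> vanishes.\<close>
  then have "AE x in M. f x = 0"
    by (intro zero f) (simp add: c_def)
  then have "AE x in M. 1 * f x + 0 * g x = 0"
    by simp
  then show False
    using indep[of 1 0] by simp
qed

section \<open>Dual functionals and normalized indicators\<close>

text \<open>The choice of a representative is harmless: by \<open>Lp_functional_class\<close> the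
  value is the same for all of them.\<close>

definition Lp_functional ::
    "real \<Rightarrow> 'a measure \<Rightarrow> 'a set \<Rightarrow>
      ('a \<Rightarrow> 'k::{real_normed_field, banach, second_countable_topology}) set \<Rightarrow> 'k" where
  "Lp_functional p M A u = Lp_mean p M A (SOME f. f \<in> u)"

lemma Lp_functional_class:
  fixes f :: "'a \<Rightarrow> 'k::{real_normed_field, banach, second_countable_topology}"
  assumes f: "f \<in> Lp_fun p M" and [measurable]: "A \<in> sets M"
  shows "Lp_functional p M A (ae_rel p M `` {f}) = Lp_mean p M A f"
proof -
  define g where "g = (SOME g. g \<in> ae_rel p M `` {f})"
  have "g \<in> ae_rel p M `` {f}"
    unfolding g_def using equiv_class_self[OF equiv_ae_rel f] by (rule someI[where P = "\<lambda>g. g \<in> ae_rel p M `` {f}"])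
  then have AE: "AE x in M. f x = g x" and [measurable]: "f \<in> borel_measurable M" "g \<in> borel_measurable M"
    by (auto simp: ae_rel_def Lp_fun_def)
  have "(LINT x|M. indicator A x *\<^sub>R g x) = (LINT x|M. indicator A x *\<^sub>R f x)"
  proof (rule integral_cong_AE)
    show "AE x in M. indicator A x *\<^sub>R g x = indicator A x *\<^sub>R f x"
      using AE by eventually_elim simp
  qed measurable
  then show ?thesis
    unfolding Lp_functional_def Lp_mean_def g_def[symmetric] by simp
qed

lemma Lp_mean_add:
  fixes f g :: "'a \<Rightarrow> 'k::{real_normed_field, banach, second_countable_topology}"
  assumes "1 \<le> p" "f \<in> Lp_fun p M" "g \<in> Lp_fun p M" "A \<in> sets M" "emeasure M A < \<infinity>"
  shows "Lp_mean p M A (\<lambda>x. f x + g x) = Lp_mean p M A f + Lp_mean p M A g"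
  using Lp_fun_integrable_on[OF assms(1,2,4,5)] Lp_fun_integrable_on[OF assms(1,3,4,5)]
  by (simp add: Lp_mean_def scaleR_add_right)

lemma Lp_mean_mult:
  fixes f :: "'a \<Rightarrow> 'k::{real_normed_field, banach, second_countable_topology}"
  assumes "1 \<le> p" "f \<in> Lp_fun p M" "A \<in> sets M" "emeasure M A < \<infinity>"
  shows "Lp_mean p M A (\<lambda>x. c * f x) = c * Lp_mean p M A f"
proof -
  have "(LINT x|M. c * (indicator A x *\<^sub>R f x)) = c * (LINT x|M. indicator A x *\<^sub>R f x)"
    by (rule integral_mult_right_zero)
  then show ?thesis
    by (simp add: Lp_mean_def)
qed

lemma Lp_functional_linear:
  fixes u v :: "('a \<Rightarrow> 'k::{real_normed_field, banach, second_countable_topology}) set"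
  assumes "1 \<le> p" "A \<in> sets M" "emeasure M A < \<infinity>" "u \<in> carrier (Lp p M)"
  shows "v \<in> carrier (Lp p M) \<Longrightarrow>
      Lp_functional p M A (u \<oplus>\<^bsub>Lp p M\<^esub> v) = Lp_functional p M A u + Lp_functional p M A v"
    and "Lp_functional p M A (c \<odot>\<^bsub>Lp p M\<^esub> u) = c * Lp_functional p M A u"
  using assms
  by (auto elim!: carrier_LpE simp: add_Lp smult_Lp Lp_functional_class Lp_fun_add Lp_fun_mult
      Lp_mean_add Lp_mean_mult)

lemma norm_Lp_functional_le:
  fixes u :: "('a \<Rightarrow> 'k::{real_normed_field, banach, second_countable_topology}) set"
  assumes "1 < p" "A \<in> sets M" "0 < emeasure M A" "emeasure M A < \<infinity>" "u \<in> carrier (Lp p M)"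
  shows "norm (Lp_functional p M A u) \<le> vnorm (Lp p M) u"
  using assms by (auto elim!: carrier_LpE simp: Lp_functional_class vnorm_Lp norm_Lp_mean_le)

definition unit_indicator :: "real \<Rightarrow> 'a measure \<Rightarrow> 'a set \<Rightarrow> 'a \<Rightarrow> 'k::real_normed_field" where
  "unit_indicator p M A x = of_real (measure M A powr (- 1 / p) * indicator A x)"

lemma norm_unit_indicator_powr:
  assumes "0 < p" "0 < emeasure M A" "emeasure M A < \<infinity>"
  shows "norm (c * unit_indicator p M A x) powr p = norm c powr p / measure M A * indicator A x"
proof -
  have "norm (c * of_real (measure M A powr (- 1 / p))) powr p
      = norm c powr p * (measure M A powr (- 1 / p)) powr p"
    by (simp only: norm_mult norm_of_real powr_mult abs_of_nonneg[OF powr_ge_zero])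
  also have "(measure M A powr (- 1 / p)) powr p = measure M A powr (- 1)"
    using assms(1) by (simp add: powr_powr)
  finally show ?thesis
    using measure_pos[OF assms(2,3)]
    by (cases "x \<in> A") (simp_all add: unit_indicator_def powr_minus_divide)
qed

lemma unit_indicator_in_Lp_fun:
  assumes "0 < p" "A \<in> sets M" "0 < emeasure M A" "emeasure M A < \<infinity>"
  shows "(unit_indicator p M A :: 'a \<Rightarrow> 'k::real_normed_field) \<in> Lp_fun p M"
proof -
  have [measurable]: "A \<in> sets M"
    by fact
  have "(unit_indicator p M A :: 'a \<Rightarrow> 'k) \<in> borel_measurable M"
    unfolding unit_indicator_def by measurable
  then show ?thesis
    using assms norm_unit_indicator_powr[OF assms(1,3,4), where c = "1 :: 'k"] by (simp add: Lp_fun_def)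
qed

text \<open>The supports are disjoint, so the \<open>p\<close>-th powers add pointwise: the two
  indicators span an isometric copy of the two-dimensional \<open>p\<close>-norm space.\<close>

lemma Lp_norm_disjoint_unit_indicators:
  fixes a b :: "'k::real_normed_field"
  assumes p: "0 < p" and A: "A \<in> sets M" "0 < emeasure M A" "emeasure M A < \<infinity>"
    and B: "B \<in> sets M" "0 < emeasure M B" "emeasure M B < \<infinity>" and disj: "A \<inter> B = {}"
  shows "Lp_norm p M (\<lambda>x. a * unit_indicator p M A x + b * unit_indicator p M B x)
    = (norm a powr p + norm b powr p) powr (1 / p)"
proof -
  have "norm (a * unit_indicator p M A x + b * unit_indicator p M B x) powr p
      = norm a powr p / measure M A * indicator A x + norm b powr p / measure M B * indicator B x" for x
  proof (cases "x \<in> A")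
    case True
    then have "x \<notin> B"
      using disj by auto
    with True show ?thesis
      using norm_unit_indicator_powr[OF p A(2,3), of a x] by (simp add: unit_indicator_def)
  next
    case False
    then show ?thesis
      using norm_unit_indicator_powr[OF p B(2,3), of b x] by (simp add: unit_indicator_def)
  qed
  then show ?thesis
    using A B measure_pos[of M A] measure_pos[of M B] by (simp add: Lp_norm_def)
qed

text \<open>The exponents \<open>1 / p - 1\<close>, \<open>1\<close> and \<open>- 1 / p\<close> of
  the measure add up to zero.\<close>

lemma Lp_mean_unit_indicator:
  assumes "A \<in> sets M" "0 < emeasure M A" "emeasure M A < \<infinity>"
  shows "Lp_mean p M A (unit_indicator p M A) = (1 :: 'k::{real_normed_field, banach, second_countable_topology})"
proof -
  let ?m = "measure M A"
  have "(LINT x|M. indicator A x *\<^sub>R (unit_indicator p M A x :: 'k))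
      = (LINT x|M. indicator A x *\<^sub>R of_real (?m powr (- 1 / p)))"
    by (rule Bochner_Integration.integral_cong) (simp_all add: unit_indicator_def indicator_def)
  also have "\<dots> = ?m *\<^sub>R of_real (?m powr (- 1 / p))"
    using assms by simp
  finally have "Lp_mean p M A (unit_indicator p M A) = (of_real (?m powr (1 / p - 1) * ?m powr 1 * ?m powr (- 1 / p)) :: 'k)"
    using measure_pos[OF assms(2,3)] by (simp add: Lp_mean_def scaleR_conv_of_real)
  also have "?m powr (1 / p - 1) * ?m powr 1 * ?m powr (- 1 / p) = 1"
    unfolding powr_add[symmetric] using measure_pos[OF assms(2,3)] by simp
  finally show ?thesis
    by simp
qed

lemma Lp_mean_disjoint_unit_indicator:
  assumes "A \<inter> B = {}"
  shows "Lp_mean p M A (unit_indicator p M B) = (0 :: 'k::{real_normed_field, banach, second_countable_topology})"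
proof -
  have "(LINT x|M. indicator A x *\<^sub>R (unit_indicator p M B x :: 'k)) = (LINT x|M. 0)"
    using assms by (intro Bochner_Integration.integral_cong) (auto simp: unit_indicator_def indicator_def)
  then show ?thesis
    by (simp add: Lp_mean_def)
qed

section \<open>Conclusion for both scalar fields at once\<close>

lemma not_universal_pointwise_BPB_domain_Lp:
  fixes M :: "'a measure"
  assumes p: "2 < p"
    and dim: "vdim (Lp p M :: ('k::{real_normed_field, euclidean_space}, ('a \<Rightarrow> 'k) set) nvs) \<ge> 2"
  shows "\<not> universal_pointwise_BPB_domain TYPE(nat \<Rightarrow> 'k) (Lp p M :: ('k, ('a \<Rightarrow> 'k) set) nvs)"
proof -
  let ?E = "Lp p M :: ('k, ('a \<Rightarrow> 'k) set) nvs"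
  let ?cls = "\<lambda>f :: 'a \<Rightarrow> 'k. ae_rel p M `` {f}"
  have p': "0 < p" "1 \<le> p" "1 < p"
    using p by simp_all
  interpret E: abelian_monoid ?E
    by (rule abelian_monoid_Lp[OF p'(1)])
  have "0 \<odot>\<^bsub>?E\<^esub> u = \<zero>\<^bsub>?E\<^esub>" if "u \<in> carrier ?E" for u
    using that by (auto elim!: carrier_LpE simp: smult_Lp zero_Lp)
  then obtain u v where uv: "u \<in> carrier ?E" "v \<in> carrier ?E"
      and indep: "\<And>c d. c \<odot>\<^bsub>?E\<^esub> u \<oplus>\<^bsub>?E\<^esub> d \<odot>\<^bsub>?E\<^esub> v = \<zero>\<^bsub>?E\<^esub> \<Longrightarrow> c = 0 \<and> d = 0"
    using vdim_ge_2_imp_independent_pair[OF E.abelian_monoid_axioms dim smult_closed_Lp] by blast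
  obtain f g where f: "f \<in> Lp_fun p M" "u = ?cls f" and g: "g \<in> Lp_fun p M" "v = ?cls g"
    using uv by (elim carrier_LpE)
  have fg: "(\<lambda>x. c * f x + d * g x) \<in> Lp_fun p M" for c d
    by (intro Lp_fun_add[OF p'(1)] Lp_fun_mult f g)
  \<comment> \<open>Independence of the two classes becomes independence of their representatives
    modulo null sets.\<close>
  have "c = 0 \<and> d = 0" if "AE x in M. c * f x + d * g x = 0" for c d
  proof (rule indep)
    have "?cls (\<lambda>x. c * f x + d * g x) = ?cls (\<lambda>_. 0)"
      using that by (subst ae_class_eq_iff) (auto simp: fg Lp_fun_zero)
    then show "c \<odot>\<^bsub>?E\<^esub> u \<oplus>\<^bsub>?E\<^esub> d \<odot>\<^bsub>?E\<^esub> v = \<zero>\<^bsub>?E\<^esub>"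
      by (simp add: f g smult_Lp add_Lp[OF p'(1)] Lp_fun_mult zero_Lp)
  qed
  then obtain A B where A: "A \<in> sets M" "0 < emeasure M A" "emeasure M A < \<infinity>"
      and B: "B \<in> sets M" "0 < emeasure M B" "emeasure M B < \<infinity>" and disj: "A \<inter> B = {}"
    using disjoint_positive_sets[OF p'(2) f(1) g(1)] by blast
  have disj': "B \<inter> A = {}"
    using disj by blast
  define eA eB :: "'a \<Rightarrow> 'k" where "eA = unit_indicator p M A" and "eB = unit_indicator p M B"
  have e: "eA \<in> Lp_fun p M" "eB \<in> Lp_fun p M"
    unfolding eA_def eB_def by (intro unit_indicator_in_Lp_fun p' A B)+
  have norm_e: "vnorm ?E (a \<odot>\<^bsub>?E\<^esub> ?cls eA \<oplus>\<^bsub>?E\<^esub> b \<odot>\<^bsub>?E\<^esub> ?cls eB)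
      = (norm a powr p + norm b powr p) powr (1 / p)" for a b
    using e Lp_norm_disjoint_unit_indicators[OF p'(1) A B disj, of a b]
    by (simp add: smult_Lp add_Lp[OF p'(1)] vnorm_Lp Lp_fun_add[OF p'(1)] Lp_fun_mult eA_def eB_def)
  have sphere: "?cls eA \<in> unit_sphere ?E" "?cls eB \<in> unit_sphere ?E"
    using norm_e[of 1 0] norm_e[of 0 1] e
    by (simp_all add: unit_sphere_def in_carrier_Lp smult_Lp add_Lp[OF p'(1)] Lp_fun_zero)
  have "\<not> pointwise_BPB ?E (renormed_linf :: ('k, nat \<Rightarrow> 'k) nvs)"
  proof (rule not_pointwise_BPB_renormed_linf[where f = "Lp_functional p M A" and g = "Lp_functional p M B",
        OF p _ _ sphere])
    fix a b :: 'k
    assume "norm a powr p + norm b powr p \<le> 1"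
    then have "(norm a powr p + norm b powr p) powr (1 / p) \<le> 1 powr (1 / p)"
      using p by (intro powr_mono2) auto
    then show "vnorm ?E (a \<odot>\<^bsub>?E\<^esub> ?cls eA \<oplus>\<^bsub>?E\<^esub> b \<odot>\<^bsub>?E\<^esub> ?cls eB) \<le> 1"
      by (simp add: norm_e)
  qed (use A B disj disj' e p' in \<open>auto simp: smult_closed_Lp Lp_functional_linear norm_Lp_functional_le
      Lp_functional_class eA_def eB_def Lp_mean_unit_indicator Lp_mean_disjoint_unit_indicator\<close>)
  then show ?thesis
    unfolding universal_pointwise_BPB_domain_def using renormed_linf_banach_space by blast
qed

theorem corollary3p6:
  fixes p :: real and \<mu> :: "'a measure"
  assumes "2 < p"
  shows "(vdim (Lp p \<mu> :: (real, ('a \<Rightarrow> real) set) nvs) \<ge> 2 \<longrightarrow>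
           \<not> universal_pointwise_BPB_domain TYPE(nat \<Rightarrow> real)
               (Lp p \<mu> :: (real, ('a \<Rightarrow> real) set) nvs))
       \<and> (vdim (Lp p \<mu> :: (complex, ('a \<Rightarrow> complex) set) nvs) \<ge> 2 \<longrightarrow>
           \<not> universal_pointwise_BPB_domain TYPE(nat \<Rightarrow> complex)
               (Lp p \<mu> :: (complex, ('a \<Rightarrow> complex) set) nvs))"
  by (intro conjI impI not_universal_pointwise_BPB_domain_Lp[OF assms])

end
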